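(* Let $n\ge2$, let $\Omega=\omega\times(-1,1)$ be a cylindrical domain in $\mathbb R^n$, with $\omega\subset\mathbb R^{n-1}$, and write points of $\Omega$ as $x=(x',y)$ with $x'\in\omega$, $y\in(-1,1)$. Let $p:\overline{\Omega}\to[1,\infty)$ be continuous and put $$\widehat{\mathcal I}(u)=\int_{\Omega}(1+|\nabla u(x)|^2)^{\frac{p(x)}{2}}\,dx.$$ Suppose that $\widehat{\mathcal I}(u^* )\le\widehat{\mathcal I}(u)$ for any nonnegative function $u\in\mathring{W}{}^1_1(\Omega)$, where $u^*$ is the Steiner symmetrization of $u$ along $y$. Then $p(x',y)$ is independent of $y$.
   Context: $\mathring{W}{}^1_1(\Omega)$ is the closure of $C_0^\infty(\Omega)$ in the Sobolev space $W^1_1(\Omega)$ of integrable functions with integrable first-order weak derivatives. The functional $\widehat{\mathcal I}$ takes values in $[0,\infty]$. For a measurable set $E\subset[-1,1]$ put $E^*=\left[-\frac{|E|}{2},\frac{|E|}{2}\right]$, where $|E|$ is Lebesgue measure. For a nonnegative measurable function $v$ on $(-1,1)$ its one-dimensional symmetrization is $v^*(y)=\int_0^\infty\chi_{\mathcal A_t^*}(y)\,dt$, where $\mathcal A_t=\{y: v(y)>t\}$ and $\chi$ denotes the characteristic function. For nonnegative $u\in\mathring{W}{}^1_1(\Omega)$, the Steiner symmetrization $u^*$ along $y$ is obtained by applying the one-dimensional symmetrization with respect to $y$ for (almost) every fixed $x'$: $u^*(x',\cdot)=(u(x',\cdot))^*$.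
   Formalization: The base ω is additionally assumed to have finite Lebesgue measure; if |ω| = ∞ the functional is infinite for every u, so the hypothesis holds for every p (e.g. p = 1 + y²) and the claim fails. *)

theory Defs
  imports "HOL-Analysis.Analysis"
begin

text \<open>
  Functions on an open set \<open>\<Omega>\<close> are represented by total functions of which only the values on
  \<open>\<Omega>\<close> matter; elements of Lebesgue and Sobolev spaces are represented by arbitrary representatives.
\<close>

primrec Ck :: "nat \<Rightarrow> ('b::euclidean_space \<Rightarrow> real) \<Rightarrow> bool" where
  "Ck 0 f \<longleftrightarrow> continuous_on UNIV f"
| "Ck (Suc k) f \<longleftrightarrow> (\<forall>x. f differentiable (at x)) \<and>
     (\<forall>b\<in>Basis. Ck k (\<lambda>x. frechet_derivative f (at x) b))"

definition Cc_smooth :: "'b::euclidean_space set \<Rightarrow> ('b \<Rightarrow> real) set" where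
  "Cc_smooth \<Omega> = {\<phi>. (\<forall>k. Ck k \<phi>) \<and> compact (closure {x. \<phi> x \<noteq> 0}) \<and> closure {x. \<phi> x \<noteq> 0} \<subseteq> \<Omega>}"

definition locally_integrable ::
    "'b::euclidean_space set \<Rightarrow> ('b \<Rightarrow> 'c::euclidean_space) \<Rightarrow> bool" where
  "locally_integrable \<Omega> f \<longleftrightarrow> (\<forall>K. compact K \<and> K \<subseteq> \<Omega> \<longrightarrow> set_integrable lebesgue K f)"

definition has_weak_gradient ::
    "'b::euclidean_space set \<Rightarrow> ('b \<Rightarrow> real) \<Rightarrow> ('b \<Rightarrow> 'b) \<Rightarrow> bool" where
  "has_weak_gradient \<Omega> u g \<longleftrightarrow>
     locally_integrable \<Omega> u \<and> locally_integrable \<Omega> g \<and>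
     (\<forall>\<phi>\<in>Cc_smooth \<Omega>. \<forall>b\<in>Basis.
        (LINT x:\<Omega>|lebesgue. u x * frechet_derivative \<phi> (at x) b) =
        - (LINT x:\<Omega>|lebesgue. (g x \<bullet> b) * \<phi> x))"

text \<open>The weak gradient is unique up to null sets, so the choice does not affect integrals.\<close>

definition weak_gradient :: "'b::euclidean_space set \<Rightarrow> ('b \<Rightarrow> real) \<Rightarrow> 'b \<Rightarrow> 'b" where
  "weak_gradient \<Omega> u = (SOME g. has_weak_gradient \<Omega> u g)"

definition W11 :: "'b::euclidean_space set \<Rightarrow> ('b \<Rightarrow> real) set" where
  "W11 \<Omega> = {u. set_integrable lebesgue \<Omega> u \<and>
     (\<exists>g. has_weak_gradient \<Omega> u g \<and> set_integrable lebesgue \<Omega> g)}"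

definition W11_norm :: "'b::euclidean_space set \<Rightarrow> ('b \<Rightarrow> real) \<Rightarrow> real" where
  "W11_norm \<Omega> u = (LINT x:\<Omega>|lebesgue. \<bar>u x\<bar>) + (LINT x:\<Omega>|lebesgue. norm (weak_gradient \<Omega> u x))"

definition W11_0 :: "'b::euclidean_space set \<Rightarrow> ('b \<Rightarrow> real) set" where
  "W11_0 \<Omega> = {u \<in> W11 \<Omega>. \<forall>e>0. \<exists>\<phi>\<in>Cc_smooth \<Omega>. W11_norm \<Omega> (\<lambda>x. u x - \<phi> x) < e}"

definition set_symm :: "real set \<Rightarrow> real set" where
  "set_symm E = {- (measure lebesgue E / 2) .. measure lebesgue E / 2}"

text \<open>
  Since the symmetrized sets are closed intervals, a null superlevel set still contributes the
  point \<open>0\<close>, and at \<open>y = 0\<close> the integral below diverges (the Bochner integral then returns \<open>0\<close>).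
  For measurable real-valued \<open>v\<close> it converges at every \<open>y \<noteq> 0\<close>, so only a null set is affected.
\<close>

definition fun_symm :: "(real \<Rightarrow> real) \<Rightarrow> real \<Rightarrow> real" where
  "fun_symm v y = (LINT t:{0..}|lebesgue. indicat_real (set_symm {z \<in> {-1<..<1}. v z > t}) y)"

definition steiner_symm :: "('a \<times> real \<Rightarrow> real) \<Rightarrow> 'a \<times> real \<Rightarrow> real" where
  "steiner_symm u = (\<lambda>(x', y). fun_symm (\<lambda>z. u (x', z)) y)"

definition I_hat ::
    "'b::euclidean_space set \<Rightarrow> ('b \<Rightarrow> real) \<Rightarrow> ('b \<Rightarrow> real) \<Rightarrow> ennreal" where
  "I_hat \<Omega> p u =
     (\<integral>\<^sup>+x\<in>\<Omega>. ennreal ((1 + (norm (weak_gradient \<Omega> u x))\<^sup>2) powr (p x / 2)) \<partial>lebesgue)"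

end

theory Submission
  imports Defs
begin

text \<open>
  For \<open>\<epsilon> \<rightarrow> 0\<close> the functional is \<open>|\<Omega>| + \<epsilon>\<^sup>2/2 \<integral> p |\<nabla>u|\<^sup>2 + o(\<epsilon>\<^sup>2)\<close> at \<open>\<epsilon> u\<close>, and symmetrization commutes with
  multiplication by \<open>\<epsilon> > 0\<close>. Hence the hypothesis implies
  \<open>\<integral> p |\<nabla>u\<^sup>*|\<^sup>2 \<le> \<integral> p |\<nabla>u|\<^sup>2\<close> for smooth \<open>u\<close> whose symmetrization is again smooth
  (\<open>dirichlet_le_of_I_hat_le\<close>).

  Functions of \<open>y\<close> alone do not suffice to conclude from this: they are compatible with a weight \<open>p\<close>
  that is even in \<open>y\<close> and has a convex square root. What decides is the derivative along the base
  \<open>\<omega>\<close>. Take \<open>u(x, y) = \<psi>(x) (A(y) + cos (N (x \<bullet> e)) A(y) (1 - A(y)))\<close>, where \<open>A\<close> rises smoothly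
  from \<open>0\<close> to \<open>1\<close> on \<open>[l, l + d1]\<close>, stays at \<open>1\<close>, and falls back to \<open>0\<close> on \<open>[r - d2, r]\<close>. For fixed
  \<open>x\<close> this is a nondecreasing function of \<open>A\<close>, so \<open>u\<^sup>*\<close> is obtained by replacing \<open>A\<close> by \<open>A\<^sup>*\<close>. Both
  ramps of \<open>A\<close> have the same shape up to scaling, and so \<open>A\<^sup>*\<close> is the plateau function of the same kind
  on \<open>[-c, c]\<close>, \<open>c = (r - l)/2\<close>, with two ramps of the average width \<open>(d1 + d2)/2\<close>
  (\<open>steiner_symm_plateau\<close>). Everything in sight is smooth with compact support.

  Add the inequalities for \<open>cos\<close> and \<open>sin\<close>, divide by \<open>N\<^sup>2\<close> and let \<open>N \<rightarrow> \<infinity>\<close>: as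
  \<open>sin\<^sup>2 + cos\<^sup>2 = 1\<close>, only \<open>\<integral> p \<psi>\<^sup>2 (A (1 - A))\<^sup>2\<close> survives on either side
  (\<open>weighted_square_le_of_modulated\<close>). The factor \<open>A (1 - A)\<close> lives on the two ramps and its square
  has there an integral proportional to the width of the ramp. If \<open>\<psi>\<close> and the ramps
  concentrate at points, with \<open>x\<close> the point of \<open>\<omega>\<close>, this becomes
  \<open>(p(x, c) + p(x, -c)) (d1 + d2)/2 \<le> p(x, l) d1 + p(x, r) d2\<close>, and \<open>d2/d1 \<rightarrow> 0\<close> gives
  \<open>p(x, c) + p(x, -c) \<le> 2 p(x, l)\<close> whenever \<open>-1 < l < l + 2c < 1\<close>
  (\<open>exponent_averaging_inequality\<close>).

  Letting \<open>c \<rightarrow> 0\<close> shows that \<open>p(x, \<cdot>)\<close> is minimal at \<open>0\<close>; then \<open>l = -s\<close> carries the minimal value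
  from \<open>-s\<close> to all \<open>\<plusminus>c\<close> with \<open>c < (1 + s)/2\<close>, and iteration of \<open>s \<mapsto> (1 + s)/2\<close> exhausts \<open>(-1, 1)\<close>
  (\<open>constant_of_averaging_inequality\<close>).

  As the weak gradient is an arbitrary choice among the possible ones, it must be known to agree
  almost everywhere with the classical gradient of a smooth function; this is integration by parts
  (\<open>has_weak_gradient_grad\<close>) together with the fundamental lemma of the calculus of variations.
\<close>

section \<open>Calculus of smooth functions\<close>

text \<open>
  The recursion for \<open>Ck\<close> mentions \<open>frechet_derivative\<close>; \<open>Ck_SucI\<close> and \<open>Ck_SucE\<close> replace it by any
  derivative that is at hand.
\<close>

declare Ck.simps(2) [simp del]

lemma Ck_continuous: "Ck k f \<Longrightarrow> continuous_on UNIV f"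
  by (cases k) (auto simp: Ck.simps(2) continuous_at_imp_continuous_on differentiable_imp_continuous_within)

lemma Ck_SucI:
  assumes "\<And>x. (f has_derivative f' x) (at x)" "\<And>b. b \<in> Basis \<Longrightarrow> Ck k (\<lambda>x. f' x b)"
  shows "Ck (Suc k) f"
proof -
  have "frechet_derivative f (at x) = f' x" for x
    using assms(1) frechet_derivative_at by metis
  then show ?thesis using assms unfolding differentiable_def Ck.simps(2) by auto
qed

lemma Ck_SucE:
  assumes "Ck (Suc k) f"
  obtains f' where "\<And>x. (f has_derivative f' x) (at x)" "\<And>b. b \<in> Basis \<Longrightarrow> Ck k (\<lambda>x. f' x b)"
proof (rule that[of "\<lambda>x. frechet_derivative f (at x)"])
qed (use assms in \<open>auto simp: Ck.simps(2) frechet_derivative_works[symmetric]\<close>)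

lemma Ck_Suc_imp: "Ck (Suc k) f \<Longrightarrow> Ck k f"
proof (induction k arbitrary: f)
  case 0 then show ?case using Ck_continuous[OF 0] by simp
next
  case (Suc k) 
  obtain f' where f': "\<And>x. (f has_derivative f' x) (at x)" "\<And>b. b \<in> Basis \<Longrightarrow> Ck (Suc k) (\<lambda>x. f' x b)"
    using Ck_SucE[OF Suc.prems] by blast
  show ?case by (rule Ck_SucI[OF f'(1)]) (use f'(2) Suc.IH in blast)
qed

lemma Ck_const: "Ck k (\<lambda>x. c)"
proof (induction k arbitrary: c)
  case (Suc k) show ?case by (rule Ck_SucI[OF has_derivative_const Suc])
qed simp

lemma Ck_bounded_linear:
  assumes "bounded_linear f" shows "Ck k f"
proof (cases k)
  case 0 then show ?thesis using assms by (simp add: linear_continuous_on)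
next
  case (Suc j) then show ?thesis using bounded_linear_imp_has_derivative[OF assms]
    using Ck_SucI[of f "\<lambda>_. f"] Ck_const by blast
qed

lemma Ck_add: "Ck k f \<Longrightarrow> Ck k g \<Longrightarrow> Ck k (\<lambda>x. f x + g x)"
proof (induction k arbitrary: f g)
  case 0 then show ?case by (auto intro: continuous_on_add)
next
  case (Suc k)
  obtain f' where f': "\<And>x. (f has_derivative f' x) (at x)" "\<And>b. b \<in> Basis \<Longrightarrow> Ck k (\<lambda>x. f' x b)"
    using Ck_SucE[OF Suc.prems(1)] by blast
  obtain g' where g': "\<And>x. (g has_derivative g' x) (at x)" "\<And>b. b \<in> Basis \<Longrightarrow> Ck k (\<lambda>x. g' x b)"
    using Ck_SucE[OF Suc.prems(2)] by blast
  show ?case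
    by (rule Ck_SucI[where f' = "\<lambda>x h. f' x h + g' x h"])
       (use f' g' Suc.IH in \<open>auto intro!: derivative_intros\<close>)
qed

lemma Ck_mult: "Ck k f \<Longrightarrow> Ck k g \<Longrightarrow> Ck k (\<lambda>x. f x * g x)"
proof (induction k arbitrary: f g)
  case 0 then show ?case by (auto intro: continuous_on_mult)
next
  case (Suc k)
  obtain f' where f': "\<And>x. (f has_derivative f' x) (at x)" "\<And>b. b \<in> Basis \<Longrightarrow> Ck k (\<lambda>x. f' x b)"
    using Ck_SucE[OF Suc.prems(1)] by blast
  obtain g' where g': "\<And>x. (g has_derivative g' x) (at x)" "\<And>b. b \<in> Basis \<Longrightarrow> Ck k (\<lambda>x. g' x b)"
    using Ck_SucE[OF Suc.prems(2)] by blast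
  show ?case
    by (rule Ck_SucI[where f' = "\<lambda>x h. f x * g' x h + f' x h * g x"])
       (use f' g' Suc.prems[THEN Ck_Suc_imp] in \<open>auto intro!: has_derivative_mult Ck_add Suc.IH\<close>)
qed

lemma Ck_compose_real: 
  fixes g :: "real \<Rightarrow> real"
  shows "Ck k g \<Longrightarrow> Ck k f \<Longrightarrow> Ck k (\<lambda>x. g (f x))"
proof (induction k arbitrary: f g)
  case 0 then show ?case by (auto intro: continuous_on_compose2)
next
  case (Suc k)
  obtain f' where f': "\<And>x. (f has_derivative f' x) (at x)" "\<And>b. b \<in> Basis \<Longrightarrow> Ck k (\<lambda>x. f' x b)"
    using Ck_SucE[OF Suc.prems(2)] by blast
  obtain g' where g': "\<And>x. (g has_derivative g' x) (at x)" "\<And>b. b \<in> Basis \<Longrightarrow> Ck k (\<lambda>x. g' x b)"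
    using Ck_SucE[OF Suc.prems(1)] by blast
  have lin: "g' x h = h * g' x 1" for x h
    using linear_scale[OF has_derivative_linear[OF g'(1)], of x h 1] by simp
  have *: "((\<lambda>x. g (f x)) has_derivative (\<lambda>h. f' x h * g' (f x) 1)) (at x)" for x
  proof -
    have "(\<lambda>h. g' (f x) (f' x h)) = (\<lambda>h. f' x h * g' (f x) 1)" by (intro ext lin)
    then show ?thesis using has_derivative_compose[OF f'(1) g'(1), of x] by metis
  qed
  show ?case
  proof (rule Ck_SucI[OF *])
    fix b :: 'a assume "b \<in> Basis"
    moreover have "Ck k (\<lambda>x. g' (f x) 1)" 
      by (rule Suc.IH[of "\<lambda>t. g' t 1" f]) (use g'(2)[of 1] Suc.prems(2)[THEN Ck_Suc_imp] in simp_all)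
    ultimately show "Ck k (\<lambda>x. f' x b * g' (f x) 1)" using f'(2) by (intro Ck_mult)
  qed
qed

lemma Ck_inverse:
  assumes "\<And>x. f x \<noteq> 0" shows "Ck k f \<Longrightarrow> Ck k (\<lambda>x. inverse (f x))"
proof (induction k)
  case 0 then show ?case using assms by (auto intro!: continuous_intros)
next
  case (Suc k)
  obtain f' where f': "\<And>x. (f has_derivative f' x) (at x)" "\<And>b. b \<in> Basis \<Longrightarrow> Ck k (\<lambda>x. f' x b)"
    using Ck_SucE[OF Suc.prems(1)] by blast
  have *: "((\<lambda>x. inverse (f x)) has_derivative (\<lambda>h. (-1) * (inverse (f x) * f' x h * inverse (f x)))) (at x)" for x
    using Deriv.has_derivative_inverse[OF assms f'(1)] by simp
  show ?case
    by (rule Ck_SucI[OF *]) (intro Ck_mult Ck_const Suc.IH f' Ck_Suc_imp[OF Suc.prems]; simp)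
qed

lemma Ck_cmult: "Ck k f \<Longrightarrow> Ck k (\<lambda>x. c * f x)"
  by (intro Ck_mult Ck_const)

lemma Ck_diff: "Ck k f \<Longrightarrow> Ck k g \<Longrightarrow> Ck k (\<lambda>x. f x - g x)"
  using Ck_add[of k f "\<lambda>x. (-1) * g x"] Ck_cmult[of k g "-1"] by simp

lemma Ck_sum: "finite A \<Longrightarrow> (\<And>i. i \<in> A \<Longrightarrow> Ck k (f i)) \<Longrightarrow> Ck k (\<lambda>x. \<Sum>i\<in>A. f i x)"
  by (induction A rule: finite_induct) (auto intro: Ck_const Ck_add)

lemma Ck_prod: "finite A \<Longrightarrow> (\<And>i. i \<in> A \<Longrightarrow> Ck k (f i)) \<Longrightarrow> Ck k (\<lambda>x. \<Prod>i\<in>A. f i x)"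
  by (induction A rule: finite_induct) (auto intro: Ck_const Ck_mult)

text \<open>
  A family of functions closed under differentiation, up to two-term linear combinations, is smooth.
  Two terms cover both \<open>sin\<close>, \<open>cos\<close> and the family \<open>e\<^sup>-\<^sup>1\<^sup>/\<^sup>t / t\<^sup>n\<close> behind bump functions.
\<close>

lemma Ck_real_iterates:
  fixes F :: "'i \<Rightarrow> real \<Rightarrow> real"
  assumes "\<And>i. \<exists>j l a b. \<forall>x. (F i has_real_derivative a * F j x + b * F l x) (at x)"
  shows "Ck k (F i)"
proof (induction k arbitrary: i)
  case 0
  obtain j l a b where "\<And>x. (F i has_real_derivative a * F j x + b * F l x) (at x)" 
    using assms[of i] by blast
  then show ?case by (auto intro!: continuous_at_imp_continuous_on DERIV_isCont)
next
  case (Suc k)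
  obtain j l a b where *: "\<And>x. (F i has_real_derivative a * F j x + b * F l x) (at x)" 
    using assms[of i] by blast
  show ?case
    by (rule Ck_SucI[OF *[unfolded has_field_derivative_def]]) 
       (auto intro!: Ck_mult Ck_add Ck_const Suc)
qed

lemma Ck_cos: "Ck k (cos :: real \<Rightarrow> real)" and Ck_sin: "Ck k (sin :: real \<Rightarrow> real)"
proof -
  define F :: "bool \<Rightarrow> real \<Rightarrow> real" where "F = (\<lambda>i. if i then cos else sin)"
  have T: "\<forall>x. (F True has_real_derivative (-1) * F False x + 0 * F False x) (at x)"
    and S: "\<forall>x. (F False has_real_derivative 1 * F True x + 0 * F False x) (at x)"
    by (auto simp: F_def intro!: derivative_eq_intros)
  have "\<exists>j l a b. \<forall>x. (F i has_real_derivative a * F j x + b * F l x) (at x)" for i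
    by (rule bool.exhaust[of i]; hypsubst) (use T S in blast)+
  from Ck_real_iterates[of F, OF this] show "Ck k (cos :: real \<Rightarrow> real)" "Ck k (sin :: real \<Rightarrow> real)"
    unfolding F_def by (metis (full_types))+
qed

section \<open>Bump functions\<close>

definition flat_exp :: "real \<Rightarrow> real" where
  "flat_exp t = (if t > 0 then exp (- (1 / t)) else 0)"

text \<open>
  All derivatives of \<open>flat_exp\<close> vanish at \<open>0\<close>, because \<open>e\<^sup>-\<^sup>1\<^sup>/\<^sup>t\<close> beats every power of \<open>t\<close>.
\<close>

lemma flat_exp_power_at_0:
  "((\<lambda>t. flat_exp t / t ^ n) \<longlongrightarrow> 0) (at 0)"
proof -
  have lim: "((\<lambda>t::real. inverse t ^ n / exp (inverse t)) \<longlongrightarrow> 0) (at_right 0)"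
    by (rule filterlim_compose[OF tendsto_power_div_exp_0 filterlim_inverse_at_top_right])
  have ev: "eventually (\<lambda>t::real. inverse t ^ n / exp (inverse t) = flat_exp t / t ^ n) (at_right 0)"
    by (auto simp: eventually_at_filter flat_exp_def exp_minus divide_simps power_inverse)
  have "((\<lambda>t. flat_exp t / t ^ n) \<longlongrightarrow> 0) (at_right 0)"
    using tendsto_cong[OF ev] lim by blast
  moreover have "((\<lambda>t. flat_exp t / t ^ n) \<longlongrightarrow> 0) (at_left 0)"
  proof -
    have "eventually (\<lambda>t::real. 0 = flat_exp t / t ^ n) (at_left 0)"
      by (auto simp: eventually_at_filter flat_exp_def)
    from tendsto_cong[OF this] show ?thesis by auto
  qed
  ultimately show ?thesis by (rule filterlim_split_at[rotated])
qed

text \<open>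
  The functions \<open>flat_exp t / t ^ n\<close>, with the value \<open>0\<close> at \<open>t = 0\<close> that division by zero supplies, form
  a family closed under differentiation.
\<close>

lemma Ck_flat_exp: "Ck k flat_exp"
proof -
  define F where "F = (\<lambda>n t. flat_exp t / t ^ n)"
  have "(F n has_real_derivative 1 * F (n+2) x + (- real n) * F (n+1) x) (at x)" for n x
  proof (cases "x = 0")
    case True
    \<comment> \<open>The difference quotient of \<open>F n\<close> at \<open>0\<close> is \<open>F (Suc n)\<close>.\<close>
    have "((\<lambda>t. (F n t - F n 0) / (t - 0)) \<longlongrightarrow> 0) (at 0)"
      using flat_exp_power_at_0[of "Suc n"] by (simp add: F_def flat_exp_def mult.commute)
    then show ?thesis using True by (simp add: F_def flat_exp_def has_field_derivative_iff)
  next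
    case False
    show ?thesis
    proof (cases "x > 0")
      case True
      have "((\<lambda>t. exp (- (1 / t)) / t ^ n) has_real_derivative 1 * F (n+2) x + (- real n) * F (n+1) x) (at x)"
        using True
        by (auto intro!: derivative_eq_intros simp: F_def flat_exp_def field_simps power2_eq_square)
           (cases n; simp add: field_simps power2_eq_square)
      then show ?thesis
        by (rule has_field_derivative_transform_within_open[OF _ open_greaterThan[of 0]])
           (use True in \<open>auto simp: F_def flat_exp_def\<close>)
    next
      case f: False
      have "((\<lambda>t. 0) has_real_derivative 1 * F (n+2) x + (- real n) * F (n+1) x) (at x)"
        using f by (auto simp: F_def flat_exp_def)
      then show ?thesis
        by (rule has_field_derivative_transform_within_open[OF _ open_lessThan[of 0]])
           (use f False in \<open>auto simp: F_def flat_exp_def\<close>)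
    qed
  qed
  then have "Ck k (F 0)" by (intro Ck_real_iterates) blast
  then show ?thesis by (simp add: F_def)
qed

lemma flat_exp_pos: "t > 0 \<Longrightarrow> flat_exp t > 0" and flat_exp_nonpos: "t \<le> 0 \<Longrightarrow> flat_exp t = 0"
  and flat_exp_nonneg: "flat_exp t \<ge> 0"
  by (auto simp: flat_exp_def)

lemma flat_exp_mono: "s \<le> t \<Longrightarrow> flat_exp s \<le> flat_exp t"
  by (auto simp: flat_exp_def intro: divide_left_mono)

definition smooth_step :: "real \<Rightarrow> real" where
  "smooth_step s = flat_exp s / (flat_exp s + flat_exp (1 - s))"

lemma smooth_step_denominator_pos: "flat_exp s + flat_exp (1 - s) > 0"
  using flat_exp_pos[of s] flat_exp_pos[of "1 - s"] flat_exp_nonneg[of s] flat_exp_nonneg[of "1 - s"]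
  by (cases "s > 0") auto

lemma smooth_step_le_0: "s \<le> 0 \<Longrightarrow> smooth_step s = 0"
  by (simp add: smooth_step_def flat_exp_nonpos)

lemma smooth_step_ge_1: "1 \<le> s \<Longrightarrow> smooth_step s = 1"
  using smooth_step_denominator_pos[of s] by (simp add: smooth_step_def flat_exp_nonpos)

lemma smooth_step_strict: "0 < s \<Longrightarrow> s < 1 \<Longrightarrow> 0 < smooth_step s \<and> smooth_step s < 1"
  using flat_exp_pos[of s] flat_exp_pos[of "1 - s"] by (simp add: smooth_step_def)

lemma smooth_step_bounds: "0 \<le> smooth_step s" "smooth_step s \<le> 1"
  using smooth_step_le_0[of s] smooth_step_ge_1[of s] smooth_step_strict[of s] by linarith+

lemma smooth_step_mono: "s \<le> t \<Longrightarrow> smooth_step s \<le> smooth_step t"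
proof -
  assume "s \<le> t"
  then have "flat_exp s * flat_exp (1 - t) \<le> flat_exp t * flat_exp (1 - s)"
    by (intro mult_mono flat_exp_mono) (auto simp: flat_exp_nonneg)
  then show ?thesis using smooth_step_denominator_pos[of s] smooth_step_denominator_pos[of t]
    by (simp add: smooth_step_def field_simps)
qed

lemma Ck_step: "Ck k smooth_step"
proof -
  have "Ck k (\<lambda>s. 1 - s)" by (intro Ck_diff Ck_const Ck_bounded_linear bounded_linear_ident)
  then have *: "Ck k (\<lambda>s. flat_exp s + flat_exp (1 - s))"
    by (intro Ck_add Ck_flat_exp Ck_compose_real[of k flat_exp])
  have "Ck k (\<lambda>s. flat_exp s * inverse (flat_exp s + flat_exp (1 - s)))"
    using smooth_step_denominator_pos by (intro Ck_mult Ck_flat_exp Ck_inverse *) (metis less_irrefl)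
  then show ?thesis unfolding smooth_step_def[abs_def] by (simp add: divide_inverse)
qed

section \<open>Classical and weak gradients\<close>

definition grad :: "('b::euclidean_space \<Rightarrow> real) \<Rightarrow> 'b \<Rightarrow> 'b" where
  "grad f x = (\<Sum>b\<in>Basis. frechet_derivative f (at x) b *\<^sub>R b)"

lemma grad_inner_Basis: "b \<in> Basis \<Longrightarrow> grad f x \<bullet> b = frechet_derivative f (at x) b"
  by (simp add: grad_def)

lemma GDERIV_imp_grad: "GDERIV f x :> D \<Longrightarrow> grad f x = D"
proof -
  assume "GDERIV f x :> D"
  then have "frechet_derivative f (at x) = (\<lambda>h. h \<bullet> D)"
    unfolding gderiv_def using frechet_derivative_at by metis
  then show ?thesis by (simp add: grad_def inner_commute[of _ D] euclidean_representation)
qed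

lemma Ck_1_GDERIV: "Ck (Suc 0) f \<Longrightarrow> GDERIV f x :> grad f x"
proof -
  assume "Ck (Suc 0) f"
  then have D: "(f has_derivative frechet_derivative f (at x)) (at x)"
    by (simp add: Ck.simps(2) frechet_derivative_works[symmetric])
  have "frechet_derivative f (at x) h = h \<bullet> grad f x" for h
  proof -
    have "frechet_derivative f (at x) (\<Sum>b\<in>Basis. (h \<bullet> b) *\<^sub>R b)
        = (\<Sum>b\<in>Basis. (h \<bullet> b) *\<^sub>R frechet_derivative f (at x) b)"
      by (simp add: linear_sum[OF has_derivative_linear[OF D]] linear_scale[OF has_derivative_linear[OF D]])
    then show ?thesis by (simp add: grad_def inner_sum_right euclidean_representation mult.commute)
  qed
  then have "frechet_derivative f (at x) = (\<lambda>h. h \<bullet> grad f x)" by (rule ext)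
  with D show ?thesis unfolding gderiv_def by metis
qed

lemma continuous_grad: "Ck (Suc 0) f \<Longrightarrow> continuous_on UNIV (grad f)"
  unfolding grad_def[abs_def] by (intro continuous_intros) (simp_all add: Ck.simps(2))

lemma grad_eq_0_outside:
  assumes "closed K" "\<And>x. x \<notin> K \<Longrightarrow> f x = 0" "x \<notin> K"
  shows "grad f x = 0"
proof -
  have "((\<lambda>x. 0) has_derivative (\<lambda>h. h \<bullet> 0)) (at x)" by simp
  then have "(f has_derivative (\<lambda>h. h \<bullet> 0)) (at x)"
    by (rule has_derivative_transform_within_open[of _ _ _ _ "- K"]) (use assms in auto)
  then show ?thesis by (intro GDERIV_imp_grad) (simp add: gderiv_def)
qed

lemma integrable_continuous_compact_support:
  fixes g :: "'b::euclidean_space \<Rightarrow> 'c::{banach, second_countable_topology}"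
  assumes "continuous_on UNIV g" "compact K" "\<And>x. x \<notin> K \<Longrightarrow> g x = 0"
  shows "integrable lborel g"
proof -
  have "(\<lambda>x. indicator K x *\<^sub>R g x) = g" using assms(3) by (auto simp: indicator_def)
  then show ?thesis
    using borel_integrable_compact[OF assms(2) continuous_on_subset[OF assms(1)]] by simp
qed

lemma bounded_continuous_compact_support:
  fixes g :: "'b::euclidean_space \<Rightarrow> 'c::real_normed_vector"
  assumes "continuous_on UNIV g" "compact K" "\<And>x. x \<notin> K \<Longrightarrow> g x = 0"
  obtains B where "B > 0" "\<And>x. norm (g x) \<le> B"
proof -
  have "compact (g ` K)" using assms by (auto intro: compact_continuous_image continuous_on_subset)
  then obtain B where B: "\<forall>y\<in>g ` K. norm y \<le> B" using compact_imp_bounded bounded_iff by metis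
  show thesis
  proof (rule that[of "max B 1"])
    show "norm (g x) \<le> max B 1" for x using B assms(3)[of x] by (cases "x \<in> K") auto
  qed auto
qed

text \<open>
  By translation invariance the integral of each difference quotient of \<open>f\<close> vanishes; the quotients
  are dominated by the Lipschitz constant of \<open>f\<close> on a fixed ball and converge to the directional
  derivative. This avoids Fubini and works for every direction \<open>b\<close> at once.
\<close>

lemma integral_grad_eq_0:
  fixes f :: "'b::euclidean_space \<Rightarrow> real"
  assumes f: "Ck (Suc 0) f" and K: "compact K" "\<And>x. x \<notin> K \<Longrightarrow> f x = 0"
  shows "(\<integral>x. grad f x \<bullet> b \<partial>lborel) = 0"
proof -
  have cf: "continuous_on UNIV f" using Ck_continuous[OF f] .
  have [measurable]: "f \<in> borel_measurable borel" by (rule borel_measurable_continuous_onI[OF cf])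
  have intf: "integrable lborel f" by (rule integrable_continuous_compact_support[OF cf K])
  obtain B where B: "B > 0" "\<And>x. norm (grad f x) \<le> B"
    using bounded_continuous_compact_support[OF continuous_grad[OF f] K(1) 
      grad_eq_0_outside[OF compact_imp_closed[OF K(1)] K(2)]] by blast
  obtain R where R: "\<And>x. x \<in> K \<Longrightarrow> norm x \<le> R" using K(1) compact_imp_bounded bounded_iff by metis
  define q where "q = (\<lambda>n x. (f (x + inverse (real (Suc n)) *\<^sub>R b) - f x) * real (Suc n))"
  have lip: "\<bar>f (x + t *\<^sub>R b) - f x\<bar> \<le> B * (\<bar>t\<bar> * norm b)" for x t
  proof -
    have "norm (f (x + t *\<^sub>R b) - f x) \<le> B * norm ((x + t *\<^sub>R b) - x)"
    proof (rule differentiable_bound[OF convex_UNIV])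
      show "(f has_derivative (\<lambda>h. h \<bullet> grad f y)) (at y)" for y
        using Ck_1_GDERIV[OF f] by (simp add: gderiv_def)
      show "onorm (\<lambda>h. h \<bullet> grad f y) \<le> B" for y
      proof (rule onorm_le)
        fix h show "norm (h \<bullet> grad f y) \<le> B * norm h" 
          using Cauchy_Schwarz_ineq2[of h "grad f y"] mult_left_mono[OF B(2)[of y] norm_ge_zero[of h]]
          by (simp add: mult.commute)
      qed
    qed auto
    then show ?thesis by simp
  qed
  have int0: "integral\<^sup>L lborel (q n) = 0" for n
  proof -
    let ?c = "inverse (real (Suc n)) *\<^sub>R b"
    have eq: "integral\<^sup>L lborel f = integral\<^sup>L lborel (\<lambda>x. f (x + ?c))"
      by (subst lborel_distr_plus[of ?c, symmetric], subst integral_distr) (auto simp: add.commute)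
    have "integrable (distr lborel borel ((+) ?c)) f" using intf lborel_distr_plus[of ?c] by simp
    then have "integrable lborel (\<lambda>x. f (x + ?c))" 
      by (subst (asm) integrable_distr_eq) (auto simp: add.commute)
    then show ?thesis using intf eq by (simp add: q_def)
  qed
  have "(\<lambda>n. integral\<^sup>L lborel (q n)) \<longlonglongrightarrow> (\<integral>x. grad f x \<bullet> b \<partial>lborel)"
  proof (rule integral_dominated_convergence[where w = "\<lambda>x. indicator (cball 0 (R + norm b)) x *\<^sub>R (B * norm b)"])
    show "(\<lambda>x. grad f x \<bullet> b) \<in> borel_measurable lborel" 
      using borel_measurable_continuous_onI[OF continuous_grad[OF f]] by simp
    show "q n \<in> borel_measurable lborel" for n unfolding q_def by measurable
    show "integrable lborel (\<lambda>x::'b. indicator (cball 0 (R + norm b)) x *\<^sub>R (B * norm b))"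
      by (intro borel_integrable_compact) auto
    show "AE x in lborel. (\<lambda>n. q n x) \<longlonglongrightarrow> grad f x \<bullet> b"
    proof (rule AE_I2)
      fix x
      have 1: "((\<lambda>t. x + t *\<^sub>R b) has_derivative (\<lambda>t. t *\<^sub>R b)) (at 0)"
        by (auto intro!: derivative_eq_intros)
      have 2: "(f has_derivative (\<lambda>h. h \<bullet> grad f x)) (at (x + 0 *\<^sub>R b))"
        using Ck_1_GDERIV[OF f] by (simp add: gderiv_def)
      have "((\<lambda>t. f (x + t *\<^sub>R b)) has_real_derivative (grad f x \<bullet> b)) (at 0)"
        using has_derivative_compose[OF 1 2] by (simp add: has_field_derivative_def inner_commute mult_commute_abs)
      then have "((\<lambda>t. (f (x + t *\<^sub>R b) - f x) / t) \<longlongrightarrow> grad f x \<bullet> b) (at 0)"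
        by (simp add: has_field_derivative_iff)
      moreover have "filterlim (\<lambda>n. inverse (real (Suc n))) (at 0) sequentially"
        by (simp add: filterlim_at LIMSEQ_inverse_real_of_nat del: of_nat_Suc)
      ultimately have "(\<lambda>n. (f (x + inverse (real (Suc n)) *\<^sub>R b) - f x) / inverse (real (Suc n))) 
          \<longlonglongrightarrow> grad f x \<bullet> b" by (rule filterlim_compose)
      then show "(\<lambda>n. q n x) \<longlonglongrightarrow> grad f x \<bullet> b" by (simp add: q_def divide_inverse del: of_nat_Suc)
    qed
    show "AE x in lborel. norm (q n x) \<le> indicator (cball 0 (R + norm b)) x *\<^sub>R (B * norm b)" for n
    proof (rule AE_I2)
      fix x
      let ?t = "inverse (real (Suc n))"
      show "norm (q n x) \<le> indicator (cball 0 (R + norm b)) x *\<^sub>R (B * norm b)"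
      proof (cases "x \<in> cball 0 (R + norm b)")
        case True
        have "\<bar>q n x\<bar> = \<bar>f (x + ?t *\<^sub>R b) - f x\<bar> * real (Suc n)" by (simp add: q_def abs_mult)
        also have "\<dots> \<le> (B * (\<bar>?t\<bar> * norm b)) * real (Suc n)" by (intro mult_right_mono lip) auto
        also have "\<dots> = B * norm b" by (simp add: field_simps)
        finally show ?thesis using True by simp
      next
        case False
        then have nx: "norm x > R + norm b" by simp
        have "?t \<le> 1" by (simp add: field_simps)
        then have "norm (?t *\<^sub>R b) \<le> 1 * norm b" by (simp only: norm_scaleR) (intro mult_right_mono; simp)
        then have "norm (x + ?t *\<^sub>R b) > R" using norm_diff_ineq[of x "?t *\<^sub>R b"] nx by linarith
        moreover have "norm x > R" using nx norm_ge_zero[of b] by linarith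
        ultimately have "f (x + ?t *\<^sub>R b) = 0" "f x = 0" using K(2) R by (meson not_le)+
        then show ?thesis using False by (simp add: q_def)
      qed
    qed
  qed
  then show ?thesis using int0 by (simp add: LIMSEQ_const_iff)
qed

lemma Cc_smoothD:
  assumes "\<phi> \<in> Cc_smooth \<Omega>"
  shows "Ck k \<phi>" "compact (closure {x. \<phi> x \<noteq> 0})" "closure {x. \<phi> x \<noteq> 0} \<subseteq> \<Omega>"
    "x \<notin> closure {x. \<phi> x \<noteq> 0} \<Longrightarrow> \<phi> x = 0" "x \<notin> closure {x. \<phi> x \<noteq> 0} \<Longrightarrow> grad \<phi> x = 0"
    "x \<notin> \<Omega> \<Longrightarrow> \<phi> x = 0" "x \<notin> \<Omega> \<Longrightarrow> grad \<phi> x = 0"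
proof -
  show *: "Ck k \<phi>" "compact (closure {x. \<phi> x \<noteq> 0})" "closure {x. \<phi> x \<noteq> 0} \<subseteq> \<Omega>"
    using assms by (auto simp: Cc_smooth_def)
  show 1: "\<phi> x = 0" if "x \<notin> closure {x. \<phi> x \<noteq> 0}" for x 
    using that closure_subset[of "{x. \<phi> x \<noteq> 0}"] by blast
  show 2: "grad \<phi> x = 0" if "x \<notin> closure {x. \<phi> x \<noteq> 0}" for x
    by (rule grad_eq_0_outside[OF closed_closure 1 that])
  show "x \<notin> \<Omega> \<Longrightarrow> \<phi> x = 0" "x \<notin> \<Omega> \<Longrightarrow> grad \<phi> x = 0" using 1 2 * by blast+
qed

lemma Cc_smoothI:
  assumes "\<And>k. Ck k \<phi>" "compact K" "K \<subseteq> \<Omega>" "\<And>x. x \<notin> K \<Longrightarrow> \<phi> x = 0"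
  shows "\<phi> \<in> Cc_smooth \<Omega>"
proof -
  have "closure {x. \<phi> x \<noteq> 0} \<subseteq> K" 
    using assms compact_imp_closed by (intro closure_minimal) auto
  moreover from this have "compact (closure {x. \<phi> x \<noteq> 0})" 
    using bounded_subset[OF compact_imp_bounded[OF assms(2)]] by (simp add: compact_eq_bounded_closed)
  ultimately show ?thesis using assms(1,3) by (auto simp: Cc_smooth_def)
qed

lemma set_integral_lebesgue_eq_lborel:
  fixes h :: "'b::euclidean_space \<Rightarrow> 'c::{banach, second_countable_topology}"
  assumes "h \<in> borel_measurable borel" "\<And>x. x \<notin> \<Omega> \<Longrightarrow> h x = 0"
  shows "(LINT x:\<Omega>|lebesgue. h x) = integral\<^sup>L lborel h"
proof -
  have "(\<lambda>x. indicator \<Omega> x *\<^sub>R h x) = h" using assms(2) by (auto simp: indicator_def)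
  then show ?thesis using assms(1) by (simp add: set_lebesgue_integral_def integral_completion)
qed

lemma locally_integrable_continuous: 
  assumes "continuous_on UNIV f" shows "locally_integrable \<Omega> f"
  unfolding locally_integrable_def set_integrable_def
proof (intro allI impI)
  fix K assume "compact K \<and> K \<subseteq> \<Omega>"
  then have i: "integrable lborel (\<lambda>x. indicator K x *\<^sub>R f x)" 
    using assms by (intro borel_integrable_compact) (auto intro: continuous_on_subset)
  then show "integrable lebesgue (\<lambda>x. indicator K x *\<^sub>R f x)"
    using integrable_completion[of _ lborel] borel_measurable_integrable[OF i] by blast
qed

text \<open>
  Integration by parts: the gradient of the product \<open>f \<phi>\<close> has integral zero.
\<close>

lemma has_weak_gradient_grad:
  assumes f: "Ck (Suc 0) f" shows "has_weak_gradient \<Omega> f (grad f)"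
  unfolding has_weak_gradient_def
proof (intro conjI ballI)
  show "locally_integrable \<Omega> f" "locally_integrable \<Omega> (grad f)"
    using f by (auto intro!: locally_integrable_continuous Ck_continuous continuous_grad)
  fix \<phi> :: "'a \<Rightarrow> real" and b :: 'a assume p: "\<phi> \<in> Cc_smooth \<Omega>" and b: "b \<in> Basis"
  define K where "K = closure {x. \<phi> x \<noteq> 0}"
  note P = Cc_smoothD[OF p, folded K_def]
  have cf: "continuous_on UNIV f" "continuous_on UNIV (grad f)" "continuous_on UNIV \<phi>" "continuous_on UNIV (grad \<phi>)"
    using Ck_continuous[OF f] continuous_grad[OF f] Ck_continuous[OF P(1)] continuous_grad[OF P(1)] by auto
  have c: "continuous_on UNIV (\<lambda>x. f x * (grad \<phi> x \<bullet> b))" "continuous_on UNIV (\<lambda>x. (grad f x \<bullet> b) * \<phi> x)"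
    using cf by (auto intro!: continuous_intros)
  have i: "integrable lborel (\<lambda>x. f x * (grad \<phi> x \<bullet> b))" "integrable lborel (\<lambda>x. (grad f x \<bullet> b) * \<phi> x)"
    by (rule integrable_continuous_compact_support[OF c(1) P(2)], simp add: P(5),
        rule integrable_continuous_compact_support[OF c(2) P(2)], simp add: P(4))
  have "grad (\<lambda>x. f x * \<phi> x) x = f x *\<^sub>R grad \<phi> x + \<phi> x *\<^sub>R grad f x" for x
    by (rule GDERIV_imp_grad[OF GDERIV_mult[OF Ck_1_GDERIV[OF f] Ck_1_GDERIV[OF P(1)]]])
  then have "(\<integral>x. (f x *\<^sub>R grad \<phi> x + \<phi> x *\<^sub>R grad f x) \<bullet> b \<partial>lborel) = 0"
    using integral_grad_eq_0[OF Ck_mult[OF f P(1)] P(2), of b] P(4) by simp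
  then have "(\<integral>x. f x * (grad \<phi> x \<bullet> b) \<partial>lborel) = - (\<integral>x. (grad f x \<bullet> b) * \<phi> x \<partial>lborel)"
    using i by (simp add: inner_add_left mult.commute)
  moreover have "(LINT x:\<Omega>|lebesgue. f x * (grad \<phi> x \<bullet> b)) = (\<integral>x. f x * (grad \<phi> x \<bullet> b) \<partial>lborel)"
    by (rule set_integral_lebesgue_eq_lborel) (use P(7) borel_measurable_continuous_onI[OF c(1)] in auto)
  moreover have "(LINT x:\<Omega>|lebesgue. (grad f x \<bullet> b) * \<phi> x) = (\<integral>x. (grad f x \<bullet> b) * \<phi> x \<partial>lborel)"
    by (rule set_integral_lebesgue_eq_lborel) (use P(6) borel_measurable_continuous_onI[OF c(2)] in auto)
  ultimately show "(LINT x:\<Omega>|lebesgue. f x * frechet_derivative \<phi> (at x) b) =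
        - (LINT x:\<Omega>|lebesgue. (grad f x \<bullet> b) * \<phi> x)"
    using grad_inner_Basis[OF b, of \<phi>] by simp
qed

lemma set_integrable_mult_test:
  fixes w :: "'b::euclidean_space \<Rightarrow> real"
  assumes w: "locally_integrable \<Omega> w" and p: "\<phi> \<in> Cc_smooth \<Omega>"
  shows "set_integrable lebesgue \<Omega> (\<lambda>x. w x * \<phi> x)"
proof -
  define K where "K = closure {x. \<phi> x \<noteq> 0}"
  note P = Cc_smoothD[OF p, folded K_def]
  obtain B where B: "B > 0" "\<And>x. norm (\<phi> x) \<le> B" 
    using bounded_continuous_compact_support[OF Ck_continuous[OF P(1)] P(2) P(4)] by metis
  have wK: "integrable lebesgue (\<lambda>x. indicator K x *\<^sub>R w x)"
    using w P(2,3) by (auto simp: locally_integrable_def set_integrable_def)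
  have [measurable]: "\<phi> \<in> borel_measurable lebesgue"
    by (rule measurable_completion) (simp add: borel_measurable_continuous_onI[OF Ck_continuous[OF P(1)]])
  have [measurable]: "(\<lambda>x. indicator K x *\<^sub>R w x) \<in> borel_measurable lebesgue"
    using wK by (rule borel_measurable_integrable)
  have "integrable lebesgue (\<lambda>x. (indicator K x *\<^sub>R w x) * \<phi> x)"
  proof (rule Bochner_Integration.integrable_bound[OF integrable_mult_right[OF wK, of B]])
    show "AE x in lebesgue. norm ((indicator K x *\<^sub>R w x) * \<phi> x) \<le> norm (B * (indicator K x *\<^sub>R w x))"
    proof (rule AE_I2)
      fix x
      have "norm (indicator K x *\<^sub>R w x) * norm (\<phi> x) \<le> norm (indicator K x *\<^sub>R w x) * B"
        by (rule mult_left_mono[OF B(2)]) simp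
      then show "norm ((indicator K x *\<^sub>R w x) * \<phi> x) \<le> norm (B * (indicator K x *\<^sub>R w x))"
        using B(1) by (simp add: abs_mult mult.commute)
    qed
  qed measurable
  moreover have "(\<lambda>x. (indicator K x *\<^sub>R w x) * \<phi> x) = (\<lambda>x. indicator \<Omega> x *\<^sub>R (w x * \<phi> x))"
  proof
    fix x show "(indicator K x *\<^sub>R w x) * \<phi> x = indicator \<Omega> x *\<^sub>R (w x * \<phi> x)"
      using P(4)[of x] P(3) by (cases "x \<in> K") (auto simp: indicator_def)
  qed
  ultimately show ?thesis by (simp add: set_integrable_def)
qed

text \<open>
  Smooth functions supported in the box that converge pointwise to its indicator function.
\<close>

definition box_bump :: "'b::euclidean_space \<Rightarrow> 'b \<Rightarrow> nat \<Rightarrow> 'b \<Rightarrow> real" where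
  "box_bump l u n x = (\<Prod>b\<in>Basis. smooth_step (real n * (x \<bullet> b - l \<bullet> b)) * smooth_step (real n * (u \<bullet> b - x \<bullet> b)))"

lemma box_bump_zero: "x \<notin> box l u \<Longrightarrow> box_bump l u n x = 0"
proof -
  assume "x \<notin> box l u"
  then obtain b where b: "b \<in> Basis" "x \<bullet> b \<le> l \<bullet> b \<or> u \<bullet> b \<le> x \<bullet> b" by (auto simp: mem_box not_less)
  then have "smooth_step (real n * (x \<bullet> b - l \<bullet> b)) * smooth_step (real n * (u \<bullet> b - x \<bullet> b)) = 0"
    by (auto simp: smooth_step_le_0 mult_nonneg_nonpos)
  then show ?thesis using b(1) by (auto simp: box_bump_def)
qed

lemma box_bump_in_Cc_smooth: 
  assumes "cbox l u \<subseteq> \<Omega>" shows "box_bump l u n \<in> Cc_smooth \<Omega>"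
proof (rule Cc_smoothI)
  show "Ck k (box_bump l u n)" for k
    unfolding box_bump_def[abs_def]
    by (intro Ck_prod Ck_mult Ck_compose_real[OF Ck_step] Ck_const Ck_diff finite_Basis
        Ck_bounded_linear bounded_linear_inner_left)
  show "compact (cbox l u)" "cbox l u \<subseteq> \<Omega>" using assms by auto
  show "x \<notin> cbox l u \<Longrightarrow> box_bump l u n x = 0" for x using box_bump_zero box_subset_cbox by blast
qed

lemma box_bump_bounds: "\<bar>box_bump l u n x\<bar> \<le> 1"
  unfolding box_bump_def abs_prod by (intro prod_le_1 conjI) (auto simp: abs_mult smooth_step_bounds intro!: mult_le_one)

lemma box_bump_tendsto: 
  fixes x :: "'b::euclidean_space"
  shows "(\<lambda>n. box_bump l u n x) \<longlonglongrightarrow> indicator (box l u) x"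
proof (cases "x \<in> box l u")
  case True
  have ev: "eventually (\<lambda>n. smooth_step (real n * c) = 1) sequentially" if "c > 0" for c
  proof -
    obtain N where N: "1 < real N * c" using reals_Archimedean3[OF \<open>c > 0\<close>] by blast
    have "smooth_step (real n * c) = 1" if "n \<ge> N" for n
    proof -
      have "real N * c \<le> real n * c" using that \<open>c > 0\<close> by (intro mult_right_mono) auto
      then show ?thesis using N by (intro smooth_step_ge_1) linarith
    qed
    then show ?thesis by (auto simp: eventually_sequentially)
  qed
  have "(\<lambda>n. box_bump l u n x) \<longlonglongrightarrow> (\<Prod>b\<in>(Basis :: 'b set). 1 * 1)"
    unfolding box_bump_def
  proof (rule tendsto_prod, rule tendsto_mult)
    fix b :: 'b assume "b \<in> Basis"
    then have "x \<bullet> b - l \<bullet> b > 0" "u \<bullet> b - x \<bullet> b > 0" using True by (auto simp: mem_box)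
    then show "(\<lambda>n. smooth_step (real n * (x \<bullet> b - l \<bullet> b))) \<longlonglongrightarrow> 1" "(\<lambda>n. smooth_step (real n * (u \<bullet> b - x \<bullet> b))) \<longlonglongrightarrow> 1"
      using tendsto_eventually[OF ev] by auto
  qed
  then show ?thesis using True by simp
qed (simp add: box_bump_zero)

lemma integral_box_eq_0_of_tests:
  fixes w :: "'b::euclidean_space \<Rightarrow> real"
  assumes w: "locally_integrable \<Omega> w"
    and tests: "\<And>\<phi>. \<phi> \<in> Cc_smooth \<Omega> \<Longrightarrow> (LINT x:\<Omega>|lebesgue. w x * \<phi> x) = 0"
    and box: "cbox l u \<subseteq> \<Omega>"
  shows "(\<integral>x. indicator (box l u) x * w x \<partial>lebesgue) = 0"
proof -
  define W where "W = (\<lambda>x. indicator (cbox l u) x *\<^sub>R w x)"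
  have iw: "integrable lebesgue W"
    using w box by (auto simp: W_def locally_integrable_def set_integrable_def)
  have [measurable]: "W \<in> borel_measurable lebesgue"
    using iw by (rule borel_measurable_integrable)
  have [measurable]: "box_bump l u n \<in> borel_measurable lebesgue" for n
    by (rule measurable_completion) 
       (simp add: borel_measurable_continuous_onI[OF Ck_continuous[OF Cc_smoothD(1)[OF box_bump_in_Cc_smooth[OF box]]]])
  have eq: "indicator \<Omega> x *\<^sub>R (w x * box_bump l u n x) = W x * box_bump l u n x" for x n
    using box box_subset_cbox[of l u] box_bump_zero[of x l u n] by (auto simp: W_def indicator_def)
  have eq2: "indicator (box l u) x * w x = W x * indicator (box l u) x" for x
    using box_subset_cbox[of l u] by (auto simp: W_def indicator_def)
  have "(\<lambda>n. \<integral>x. W x * box_bump l u n x \<partial>lebesgue)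
        \<longlonglongrightarrow> (\<integral>x. W x * indicator (box l u) x \<partial>lebesgue)"
  proof (rule integral_dominated_convergence[where w = "\<lambda>x. \<bar>W x\<bar>"])
    show "integrable lebesgue (\<lambda>x. \<bar>W x\<bar>)" using iw by (rule integrable_abs)
    show "AE x in lebesgue. (\<lambda>n. W x * box_bump l u n x)
        \<longlonglongrightarrow> W x * indicator (box l u) x"
      by (intro AE_I2 tendsto_mult tendsto_const box_bump_tendsto)
    show "AE x in lebesgue. norm (W x * box_bump l u n x) \<le> \<bar>W x\<bar>" for n
    proof (rule AE_I2)
      fix x show "norm (W x * box_bump l u n x) \<le> \<bar>W x\<bar>"
        using mult_left_mono[OF box_bump_bounds[of l u n x] abs_ge_zero[of "W x"]]
        by (simp only: real_norm_def abs_mult mult_1_right)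
    qed
    show "(\<lambda>x. W x * indicator (box l u) x) \<in> borel_measurable lebesgue"
      "(\<lambda>x. W x * box_bump l u n x) \<in> borel_measurable lebesgue" for n
      by (intro borel_measurable_times borel_measurable_indicator \<open>W \<in> borel_measurable lebesgue\<close>; simp)+
  qed
  moreover have "(\<integral>x. W x * box_bump l u n x \<partial>lebesgue) = 0" for n
    using tests[OF box_bump_in_Cc_smooth[OF box], of n] unfolding set_lebesgue_integral_def eq .
  ultimately show ?thesis unfolding eq2 by (simp add: LIMSEQ_const_iff)
qed

lemma Int_stable_boxes: "Int_stable (range (\<lambda>(a, b). box a b :: 'b::euclidean_space set))"
  by (auto simp: Int_stable_def box_Int_box)

text \<open>
  The sets over which \<open>w\<close> integrates to zero form a Dynkin system that contains the boxes, hence all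
  Borel sets. The Borel version \<open>g\<close> of \<open>w\<close> is needed because boxes generate only the Borel sets.
\<close>

lemma AE_eq_0_on_box:
  fixes w :: "'b::euclidean_space \<Rightarrow> real"
  assumes w: "set_integrable lebesgue (box l u) w"
    and boxes: "\<And>c d. box c d \<noteq> {} \<Longrightarrow> box c d \<subseteq> box l u \<Longrightarrow> (\<integral>x. indicator (box c d) x * w x \<partial>lebesgue) = 0"
  shows "AE x in lebesgue. x \<in> box l u \<longrightarrow> w x = 0"
proof -
  define f where "f = (\<lambda>x. indicator (box l u) x *\<^sub>R w x)"
  have f: "integrable lebesgue f" using w by (simp add: f_def set_integrable_def)
  have [measurable]: "f \<in> borel_measurable lebesgue" using f by (rule borel_measurable_integrable)
  obtain g where g[measurable]: "g \<in> borel_measurable lborel" and "AE x in lborel. f x = g x"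
    using completion_ex_borel_measurable_real[of f lborel] by auto
  then have AE: "AE x in lebesgue. f x = g x" using AE_completion by blast
  have gl[measurable]: "g \<in> borel_measurable lebesgue" by (rule measurable_completion[OF g])
  have "integrable lebesgue g" by (rule integrable_cong_AE_imp[OF f gl AE])
  then have ig: "integrable lborel g" using integrable_completion[OF g] by simp
  have eq: "(\<integral>x. indicator A x * g x \<partial>lborel) = (\<integral>x. indicator A x * f x \<partial>lebesgue)" if [measurable]: "A \<in> sets borel" for A
  proof -
    have m: "(\<lambda>x. indicator A x * g x) \<in> borel_measurable lborel" by measurable
    have "(\<integral>x. indicator A x * f x \<partial>lebesgue) = (\<integral>x. indicator A x * g x \<partial>lebesgue)"
    proof (rule integral_cong_AE)
      show "(\<lambda>x. indicat_real A x * f x) \<in> borel_measurable lebesgue" "(\<lambda>x. indicat_real A x * g x) \<in> borel_measurable lebesgue"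
        by (intro borel_measurable_times borel_measurable_indicator gl \<open>f \<in> borel_measurable lebesgue\<close>; simp)+
    qed (use AE in auto)
    then show ?thesis using integral_completion[OF m] by simp
  qed
  have ibox: "(\<integral>x. indicator (box a b) x * f x \<partial>lebesgue) = 0" for a b
  proof -
    obtain c d where cd: "box a b \<inter> box l u = box c d" using box_Int_box[of a b l u] by blast
    have "(\<lambda>x. indicator (box a b) x * f x) = (\<lambda>x. indicator (box c d) x * w x)"
      unfolding f_def cd[symmetric] by (auto simp: indicator_def)
    moreover have "(\<integral>x. indicator (box c d) x * w x \<partial>lebesgue) = 0"
      using boxes[of c d] cd by (cases "box c d = {}") auto
    ultimately show ?thesis by simp
  qed
  have tot: "(\<integral>x. g x \<partial>lborel) = 0"
  proof -
    have "(\<lambda>x. indicator (box l u) x * f x) = f" by (auto simp: f_def indicator_def)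
    then show ?thesis using ibox[of l u] integral_cong_AE[OF _ gl AE] integral_completion[OF g] by simp
  qed
  have borel0: "set_lebesgue_integral lborel A g = 0" if A: "A \<in> sets borel" for A
  proof -
    have A': "A \<in> sigma_sets UNIV (range (\<lambda>(a, b). box a b))" using A by (simp add: borel_eq_box)
    have sub: "range (\<lambda>(a, b). box a b :: 'b set) \<subseteq> Pow UNIV" by simp
    from Int_stable_boxes sub A' show ?thesis
    proof (induct rule: sigma_sets_induct_disjoint)
      case (basic A)
      then show ?case using eq ibox by (auto simp: set_lebesgue_integral_def)
    next
      case empty then show ?case by (simp add: set_lebesgue_integral_def)
    next
      case (compl A)
      then have [measurable]: "A \<in> sets borel" by (simp add: borel_eq_box)
      have i: "integrable lborel (\<lambda>x. indicator A x *\<^sub>R g x)" 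
        using integrable_mult_indicator[OF _ ig, of A] by simp
      have "(\<lambda>x. indicator (UNIV - A) x *\<^sub>R g x) = (\<lambda>x. g x - indicator A x *\<^sub>R g x)"
        by (auto simp: indicator_def)
      then show ?case using compl(2) tot ig i by (simp add: set_lebesgue_integral_def)
    next
      case (union A)
      have m: "A i \<in> sets lborel" for i using union(2) by (auto simp: borel_eq_box)
      have "set_lebesgue_integral lborel (\<Union>i. A i) g = (\<Sum>i. set_lebesgue_integral lborel (A i) g)"
        by (rule lebesgue_integral_countable_add)
           (use m union(1) in \<open>auto simp: disjoint_family_on_def set_integrable_def
              intro: integrable_mult_indicator[OF sets.countable_UN ig, of _ UNIV, simplified]\<close>)
      then show ?case using union(3) by simp
    qed
  qed
  have "AE x in lborel. g x = 0"
    by (rule density_unique_real[OF ig integrable_zero]) (use borel0 in \<open>auto simp: set_lebesgue_integral_def\<close>)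
  then have "AE x in lebesgue. g x = 0" using AE_completion by blast
  with AE show ?thesis by eventually_elim (auto simp: f_def)
qed

text \<open>
  Bumps inside a box whose closure lies in \<open>\<Omega>\<close> show that \<open>w\<close> has integral zero over that box, and
  countably many such boxes cover \<open>\<Omega>\<close>.
\<close>

lemma fundamental_lemma_of_variations:
  fixes w :: "'b::euclidean_space \<Rightarrow> real"
  assumes "open \<Omega>" and w: "locally_integrable \<Omega> w"
    and tests: "\<And>\<phi>. \<phi> \<in> Cc_smooth \<Omega> \<Longrightarrow> (LINT x:\<Omega>|lebesgue. w x * \<phi> x) = 0"
  shows "AE x in lebesgue. x \<in> \<Omega> \<longrightarrow> w x = 0"
proof -
  define F where "F = {box l u | l u. cbox l u \<subseteq> \<Omega>}"
  have "\<Union>F = \<Omega>"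
  proof
    show "\<Union>F \<subseteq> \<Omega>" using box_subset_cbox by (auto simp: F_def)
    show "\<Omega> \<subseteq> \<Union>F"
    proof
      fix x assume "x \<in> \<Omega>"
      then obtain l u where "cbox l u \<subseteq> \<Omega>" "x \<in> box l u" using open_contains_cbox[OF \<open>open \<Omega>\<close>] by metis
      then show "x \<in> \<Union>F" by (auto simp: F_def)
    qed
  qed
  moreover obtain F' where F': "F' \<subseteq> F" "countable F'" "\<Union>F' = \<Union>F"
    by (rule Lindelof[of F]) (auto simp: F_def)
  moreover have "AE x in lebesgue. x \<in> S \<longrightarrow> w x = 0" if "S \<in> F'" for S
  proof -
    obtain l u where S: "S = box l u" "cbox l u \<subseteq> \<Omega>" using subsetD[OF F'(1) \<open>S \<in> F'\<close>] unfolding F_def by auto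
    have "set_integrable lebesgue (cbox l u) w" using w S by (auto simp: locally_integrable_def)
    then have "set_integrable lebesgue (box l u) w" 
      by (rule set_integrable_subset) (auto simp: box_subset_cbox)
    moreover have "(\<integral>x. indicator (box c d) x * w x \<partial>lebesgue) = 0" if "box c d \<noteq> {}" "box c d \<subseteq> box l u" for c d
    proof (rule integral_box_eq_0_of_tests[OF w tests])
      have "cbox c d \<subseteq> cbox l u" using that closure_box[of c d] closure_mono[OF subset_trans[OF that(2) box_subset_cbox]] by simp
      then show "cbox c d \<subseteq> \<Omega>" using S by blast
    qed
    ultimately show ?thesis unfolding S(1) by (rule AE_eq_0_on_box)
  qed
  then have "AE x in lebesgue. \<forall>S\<in>F'. x \<in> S \<longrightarrow> w x = 0" using F'(2) by (intro AE_ball_countable[THEN iffD2]) auto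
  ultimately show ?thesis by (auto elim!: eventually_mono)
qed

lemma locally_integrable_inner_diff:
  assumes "locally_integrable \<Omega> g" "locally_integrable \<Omega> h"
  shows "locally_integrable \<Omega> (\<lambda>x. (g x - h x) \<bullet> b)"
  unfolding locally_integrable_def set_integrable_def
proof (intro allI impI)
  fix K assume "compact K \<and> K \<subseteq> \<Omega>"
  then have "integrable lebesgue (\<lambda>x. (indicator K x *\<^sub>R g x - indicator K x *\<^sub>R h x) \<bullet> b)"
    using assms by (auto simp: locally_integrable_def set_integrable_def simp del: inner_diff_left
        intro!: integrable_inner_left Bochner_Integration.integrable_diff)
  then show "integrable lebesgue (\<lambda>x. indicator K x *\<^sub>R ((g x - h x) \<bullet> b))"
    by (simp add: algebra_simps)
qed

lemma has_weak_gradient_unique: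
  assumes "open \<Omega>" "has_weak_gradient \<Omega> u g" "has_weak_gradient \<Omega> u h"
  shows "AE x in lebesgue. x \<in> \<Omega> \<longrightarrow> g x = h x"
proof -
  have g: "locally_integrable \<Omega> g" and h: "locally_integrable \<Omega> h"
    using assms by (auto simp: has_weak_gradient_def)
  have "AE x in lebesgue. x \<in> \<Omega> \<longrightarrow> (g x - h x) \<bullet> b = 0" if b: "b \<in> Basis" for b
  proof (rule fundamental_lemma_of_variations[OF assms(1) locally_integrable_inner_diff[OF g h]])
    fix \<phi> :: "'a \<Rightarrow> real" assume p: "\<phi> \<in> Cc_smooth \<Omega>"
    have l0: "locally_integrable \<Omega> (\<lambda>x. 0 :: 'a)" by (simp add: locally_integrable_def set_integrable_def)
    have "set_integrable lebesgue \<Omega> (\<lambda>x. (g x \<bullet> b) * \<phi> x)" "set_integrable lebesgue \<Omega> (\<lambda>x. (h x \<bullet> b) * \<phi> x)"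
      using set_integrable_mult_test[OF locally_integrable_inner_diff[OF g l0] p, of b]
        set_integrable_mult_test[OF locally_integrable_inner_diff[OF h l0] p, of b] by simp_all
    moreover have "(LINT x:\<Omega>|lebesgue. (g x \<bullet> b) * \<phi> x) = (LINT x:\<Omega>|lebesgue. (h x \<bullet> b) * \<phi> x)"
      using assms(2,3) p b by (fastforce simp: has_weak_gradient_def)
    ultimately show "(LINT x:\<Omega>|lebesgue. ((g x - h x) \<bullet> b) * \<phi> x) = 0"
      by (simp add: inner_diff_left left_diff_distrib set_integral_diff)
  qed
  then have "AE x in lebesgue. \<forall>b\<in>Basis. x \<in> \<Omega> \<longrightarrow> (g x - h x) \<bullet> b = 0" 
    by (intro AE_ball_countable[THEN iffD2]) (auto simp: countable_finite)
  then show ?thesis by eventually_elim (auto simp: inner_diff_left intro: euclidean_eqI)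
qed

lemma weak_gradient_eq_grad:
  assumes "open \<Omega>" "Ck (Suc 0) f"
  shows "AE x in lebesgue. x \<in> \<Omega> \<longrightarrow> weak_gradient \<Omega> f x = grad f x"
  by (rule has_weak_gradient_unique[OF assms(1) _ has_weak_gradient_grad[OF assms(2)]])
     (unfold weak_gradient_def, rule someI[of "has_weak_gradient \<Omega> f"], rule has_weak_gradient_grad[OF assms(2)])

text \<open>
  The approximating test function is \<open>u\<close> itself; what has to be shown about the norm is that the
  weak gradient chosen for the zero function vanishes almost everywhere.
\<close>

lemma Cc_smooth_subset_W11_0:
  assumes "open \<Omega>" "u \<in> Cc_smooth \<Omega>"
  shows "u \<in> W11_0 \<Omega>"
proof -
  define K where "K = closure {x. u x \<noteq> 0}"
  note U = Cc_smoothD[OF assms(2), folded K_def]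
  have si: "set_integrable lebesgue \<Omega> f" 
    if c: "continuous_on UNIV f" and K: "\<And>x. x \<notin> K \<Longrightarrow> f x = 0" for f :: "'a \<Rightarrow> 'c::euclidean_space"
  proof -
    have "indicator \<Omega> x *\<^sub>R f x = f x" for x
      using K[of x] U(3) by (cases "x \<in> K") (auto simp: indicator_def)
    moreover have "integrable lebesgue f" 
      using integrable_completion[of f lborel] integrable_continuous_compact_support[OF c U(2) K]
        borel_measurable_continuous_onI[OF c] by simp
    ultimately show ?thesis by (simp add: set_integrable_def)
  qed
  have "u \<in> W11 \<Omega>" unfolding W11_def
    using si[OF Ck_continuous[OF U(1)] U(4)] si[OF continuous_grad[OF U(1)] U(5)] 
      has_weak_gradient_grad[OF U(1)] by blast
  moreover have "W11_norm \<Omega> (\<lambda>x. u x - u x) = 0"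
  proof -
    have ae: "AE x in lebesgue. x \<in> \<Omega> \<longrightarrow> weak_gradient \<Omega> (\<lambda>x. 0) x = 0"
      using weak_gradient_eq_grad[OF assms(1) Ck_const, of 0] 
      by eventually_elim (simp add: GDERIV_imp_grad[OF GDERIV_const])
    have "(LINT x:\<Omega>|lebesgue. norm (weak_gradient \<Omega> (\<lambda>x. 0) x)) = 0"
      unfolding set_lebesgue_integral_def
      by (rule integral_eq_zero_AE) (use ae in eventually_elim, auto simp: indicator_def)
    then show ?thesis by (simp add: W11_norm_def)
  qed
  ultimately show ?thesis using assms(2) by (force simp: W11_0_def)
qed

section \<open>Steiner symmetrization of plateau functions\<close>

lemma set_symm_interval:
  assumes "l \<le> r"
  shows "y \<in> set_symm {l<..<r} \<longleftrightarrow> \<bar>y\<bar> \<le> (r - l) / 2"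
proof -
  have m: "measure lebesgue {l<..<r} = r - l" using assms by simp
  show ?thesis unfolding set_symm_def m atLeastAtMost_iff abs_le_iff by argo
qed

text \<open>
  The level at which the closed symmetrized interval and the open superlevel set may disagree
  is the single value \<open>t = g\<close>, so it does not affect the integral.
\<close>

lemma integral_of_almost_lower_set:
  assumes g: "0 \<le> g" and S: "\<And>t. t \<ge> 0 \<Longrightarrow> t \<noteq> g \<Longrightarrow> P t \<longleftrightarrow> t < g"
  shows "(LINT t:{0..}|lebesgue. of_bool (P t)) = (g::real)"
proof (cases "P g")
  case True
  have "(\<lambda>t. indicator {0..} t *\<^sub>R of_bool (P t)) = indicat_real {0..g}"
    using S True g by (force simp: indicator_def)
  then show ?thesis using g by (simp add: set_lebesgue_integral_def)
next
  case False
  have "(\<lambda>t. indicator {0..} t *\<^sub>R of_bool (P t)) = indicat_real {0..<g}"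
    using S False g by (force simp: indicator_def)
  then show ?thesis using g by (simp add: set_lebesgue_integral_def)
qed

lemma superlevel_ray:
  fixes G :: "real \<Rightarrow> real"
  assumes G: "mono G" "continuous_on UNIV G" "G 0 = 0" and t: "0 \<le> t" "t < G 1"
  obtains \<sigma> where "0 \<le> \<sigma>" "\<sigma> < 1" "\<And>s. t < G s \<longleftrightarrow> \<sigma> < s" "G \<sigma> = t"
proof -
  define S where "S = {s. G s \<le> t}"
  have S0: "0 \<in> S" and ub: "s < 1" if "s \<in> S" for s
    using t G(3) that monoD[OF G(1), of 1 s] by (auto simp: S_def not_le[symmetric])
  have "0 \<in> S" using t G(3) by (simp add: S_def)
  have bdd: "bdd_above S" using ub by (intro bdd_aboveI[of _ 1]) (auto intro: less_imp_le)
  have "closed S" unfolding S_def using G(2) by (intro closed_Collect_le continuous_on_const) auto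
  then have \<sigma>: "Sup S \<in> S" using closed_contains_Sup[of S] \<open>0 \<in> S\<close> bdd by blast
  have iff: "t < G s \<longleftrightarrow> Sup S < s" for s
  proof
    assume "t < G s" 
    show "Sup S < s"
    proof (rule ccontr)
      assume "\<not> Sup S < s" 
      then have "G s \<le> G (Sup S)" using G(1) by (auto simp: mono_def)
      then show False using \<sigma> \<open>t < G s\<close> by (simp add: S_def)
    qed
  next
    assume "Sup S < s" then show "t < G s" using cSup_upper[OF _ bdd, of s] by (force simp: S_def)
  qed
  \<comment> \<open>By continuity the value at the threshold is the limit of values above \<open>t\<close>.\<close>
  have "t \<le> G (Sup S)"
  proof (rule tendsto_lowerbound)
    show "(G \<longlongrightarrow> G (Sup S)) (at_right (Sup S))"
      using G(2) by (simp add: continuous_on_def) (metis tendsto_within_subset subset_UNIV)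
    show "\<forall>\<^sub>F s in at_right (Sup S). t \<le> G s"
      using iff by (auto simp: eventually_at_filter less_imp_le)
  qed simp
  then show thesis using that[of "Sup S"] \<sigma> ub iff cSup_upper[OF \<open>0 \<in> S\<close> bdd] by (auto simp: S_def)
qed

text \<open>
  The superlevel set of the trapezoid profile at a level \<open>t = G \<sigma>\<close> is the interval
  \<open>(l + d1 \<sigma>, r - d2 \<sigma>)\<close>; its half length \<open>c - d \<sigma>\<close> is that of the corresponding interval for the
  symmetric trapezoid with both ramps of width \<open>d\<close>. The point \<open>y = 0\<close> is excluded because the
  symmetrization of the empty set is \<open>{0}\<close>.
\<close>

lemma fun_symm_trapezoid:
  fixes G :: "real \<Rightarrow> real"
  assumes G: "mono G" "continuous_on UNIV G" "G 0 = 0" "\<And>s. s \<ge> 1 \<Longrightarrow> G s = G 1"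
    and lr: "-1 < l" "r < 1" "0 < d1" "0 < d2" "l + d1 \<le> r - d2" 
    and low: "\<And>s. s \<le> 0 \<Longrightarrow> G s = 0"
    and c: "c = (r - l) / 2" and d: "d = (d1 + d2) / 2" and y: "y \<noteq> 0"
  shows "fun_symm (\<lambda>z. G (min ((z - l) / d1) ((r - z) / d2))) y = G (min ((y + c) / d) ((c - y) / d))"
proof -
  define m where "m = min ((y + c) / d) ((c - y) / d)"
  define v where "v = (\<lambda>z. G (min ((z - l) / d1) ((r - z) / d2)))"
  have d0: "d > 0" using lr d by simp
  have le1: "G s \<le> G 1" for s using G(4)[of s] monoD[OF G(1), of s 1] by (cases "s \<ge> 1") auto
  have ge0: "0 \<le> G s" for s using low[of s] monoD[OF G(1), of 0 s] G(3) by (cases "s \<le> 0") auto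
  have "y \<in> set_symm {z \<in> {-1<..<1}. v z > t} \<longleftrightarrow> t < G m" if t: "t \<ge> 0" "t \<noteq> G m" for t
  proof (cases "t < G 1")
    case False
    then have e: "{z \<in> {-1<..<1}. v z > t} = {}" using le1 order.strict_trans2 by (fastforce simp: v_def)
    moreover have "\<not> t < G m" using False le1[of m] by linarith
    ultimately show ?thesis using y unfolding e by (simp add: set_symm_def)
  next
    case True
    obtain \<sigma> where \<sigma>: "0 \<le> \<sigma>" "\<sigma> < 1" and iff: "\<And>s. t < G s \<longleftrightarrow> \<sigma> < s" and G\<sigma>: "G \<sigma> = t"
      using superlevel_ray[OF G(1-3) t(1) True] by metis
    have "v z > t \<longleftrightarrow> l + d1 * \<sigma> < z \<and> z < r - d2 * \<sigma>" for z
      unfolding v_def iff using lr by (auto simp: field_simps)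
    moreover have "0 \<le> d1 * \<sigma>" "0 \<le> d2 * \<sigma>" using \<sigma> lr by auto
    ultimately have "{z \<in> {-1<..<1}. v z > t} = {l + d1 * \<sigma><..<r - d2 * \<sigma>}" 
      using lr by (auto 0 0)
    moreover have "d1 * \<sigma> \<le> d1 * 1" "d2 * \<sigma> \<le> d2 * 1" using \<sigma> lr by (intro mult_left_mono; simp)+
    then have "l + d1 * \<sigma> \<le> r - d2 * \<sigma>" using lr(5) by linarith
    ultimately have "y \<in> set_symm {z \<in> {-1<..<1}. v z > t} \<longleftrightarrow> \<bar>y\<bar> \<le> (r - d2 * \<sigma> - (l + d1 * \<sigma>)) / 2"
      by (simp add: set_symm_interval)
    also have "(r - d2 * \<sigma> - (l + d1 * \<sigma>)) / 2 = c - d * \<sigma>" by (simp add: c d field_simps)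
    also have "\<bar>y\<bar> \<le> c - d * \<sigma> \<longleftrightarrow> \<sigma> \<le> m"
      using d0 by (auto simp: m_def field_simps abs_le_iff)
    also have "\<dots> \<longleftrightarrow> \<sigma> < m" using t(2) G\<sigma> by (auto simp: order.order_iff_strict)
    finally show ?thesis using iff by simp
  qed
  then have "(LINT t:{0..}|lebesgue. of_bool (y \<in> set_symm {z \<in> {-1<..<1}. v z > t})) = G m"
    by (intro integral_of_almost_lower_set ge0)
  then show ?thesis unfolding m_def[symmetric] by (simp add: fun_symm_def v_def indicator_def)
qed

text \<open>
  A smooth function on the line that rises from \<open>0\<close> to \<open>1\<close> on \<open>[l, l + d1]\<close>, stays at \<open>1\<close> and falls to \<open>0\<close>
  on \<open>[r - d2, r]\<close>. The product form makes smoothness evident; \<open>plateau_eq_smooth_step_min\<close> gives the form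
  suited to symmetrization.
\<close>

definition plateau :: "real \<Rightarrow> real \<Rightarrow> real \<Rightarrow> real \<Rightarrow> real \<Rightarrow> real" where
  "plateau l r d1 d2 y = smooth_step ((y - l) / d1) * smooth_step ((r - y) / d2)"

lemma plateau_eq_smooth_step_min:
  assumes "0 < d1" "0 < d2" "l + d1 \<le> r - d2"
  shows "plateau l r d1 d2 y = smooth_step (min ((y - l) / d1) ((r - y) / d2))"
proof (cases "y \<le> r - d2")
  case True
  then have "(r - y) / d2 \<ge> 1" using assms by (simp add: field_simps)
  then show ?thesis using smooth_step_bounds(2)[of "(y - l) / d1"] smooth_step_mono[of "(y - l) / d1" "(r - y) / d2"]
    by (auto simp: plateau_def smooth_step_ge_1 min_def)
next
  case False
  then have "(y - l) / d1 \<ge> 1" using assms by (simp add: field_simps)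
  then show ?thesis by (auto simp: plateau_def smooth_step_ge_1 min_def)
qed

text \<open>
  A function of \<open>(x, y)\<close> that is nondecreasing in a plateau function of \<open>y\<close> is symmetrized by
  symmetrizing the plateau. At \<open>y = 0\<close> the integral that defines the symmetrization is over all levels
  \<open>t \<ge> 0\<close>, whence a value independent of the function; it lies on a null set.
\<close>

lemma steiner_symm_plateau:
  fixes F :: "'a \<Rightarrow> real \<Rightarrow> real"
  assumes F: "\<And>x s t. 0 \<le> s \<Longrightarrow> s \<le> t \<Longrightarrow> t \<le> 1 \<Longrightarrow> F x s \<le> F x t" "\<And>x. continuous_on UNIV (F x)" "\<And>x. F x 0 = 0"
    and lr: "-1 < l" "r < 1" "0 < d1" "0 < d2" "l + d1 \<le> r - d2" 
    and c: "c = (r - l) / 2" and d: "d = (d1 + d2) / 2"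
  shows "steiner_symm (\<lambda>(x, y). F x (plateau l r d1 d2 y)) =
    (\<lambda>(x, y). if y = 0 then (LINT t:{0 :: real..}|lebesgue. 1) else F x (plateau (-c) c d d y))"
proof (intro ext, clarify)
  fix x and y :: real
  show "steiner_symm (\<lambda>(x, y). F x (plateau l r d1 d2 y)) (x, y) =
    (if y = 0 then (LINT t:{0 :: real..}|lebesgue. 1) else F x (plateau (-c) c d d y))"
  proof (cases "y = 0")
    case True
    then show ?thesis by (simp add: steiner_symm_def fun_symm_def set_symm_def indicator_def)
  next
    case False
    have m: "mono (\<lambda>s. F x (smooth_step s))" by (intro monoI F smooth_step_bounds smooth_step_mono)
    have c1: "continuous_on UNIV (\<lambda>s. F x (smooth_step s))"
      using continuous_on_compose2[OF F(2) Ck_continuous[OF Ck_step]] by blast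
    have cd: "0 < d" "- c + d \<le> c - d" using lr c d by auto
    have "fun_symm (\<lambda>z. F x (smooth_step (min ((z - l) / d1) ((r - z) / d2)))) y
        = F x (smooth_step (min ((y + c) / d) ((c - y) / d)))"
      using F(3) by (intro fun_symm_trapezoid[OF m c1]) (use lr c d False in \<open>auto simp: smooth_step_le_0 smooth_step_ge_1\<close>)
    then show ?thesis using False plateau_eq_smooth_step_min[OF lr(3-5)] plateau_eq_smooth_step_min[OF cd(1,1,2)]
      by (simp add: steiner_symm_def)
  qed
qed

lemma has_weak_gradient_cong_AE:
  fixes u v :: "'b::euclidean_space \<Rightarrow> real"
  assumes "open \<Omega>" and [measurable]: "u \<in> borel_measurable borel" "v \<in> borel_measurable borel"
    and AE: "AE x in lebesgue. u x = v x"
  shows "has_weak_gradient \<Omega> u g = has_weak_gradient \<Omega> v g"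
proof -
  have ul: "u \<in> borel_measurable lebesgue" and vl: "v \<in> borel_measurable lebesgue"
    by (auto intro: measurable_completion)
  have "set_integrable lebesgue K u = set_integrable lebesgue K v" if "compact K" for K
    unfolding set_integrable_def
  proof (rule integrable_cong_AE)
    show "(\<lambda>x. indicator K x *\<^sub>R u x) \<in> borel_measurable lebesgue" "(\<lambda>x. indicator K x *\<^sub>R v x) \<in> borel_measurable lebesgue"
      using borel_compact[OF that] 
      by (intro borel_measurable_scaleR borel_measurable_indicator ul vl; simp)+
  qed (use AE in eventually_elim, simp)
  moreover have "(LINT x:\<Omega>|lebesgue. u x * frechet_derivative \<phi> (at x) b) = (LINT x:\<Omega>|lebesgue. v x * frechet_derivative \<phi> (at x) b)"
    if \<phi>: "\<phi> \<in> Cc_smooth \<Omega>" and b: "b \<in> Basis" for \<phi> b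
    unfolding set_lebesgue_integral_def
  proof (rule integral_cong_AE)
    have "continuous_on UNIV (\<lambda>x. frechet_derivative \<phi> (at x) b)"
      using Cc_smoothD(1)[OF \<phi>, of "Suc 0"] b by (auto simp: Ck.simps(2))
    then have D: "(\<lambda>x. frechet_derivative \<phi> (at x) b) \<in> borel_measurable lebesgue"
      by (intro measurable_completion) (simp add: borel_measurable_continuous_onI)
    show "(\<lambda>x. indicator \<Omega> x *\<^sub>R (u x * frechet_derivative \<phi> (at x) b)) \<in> borel_measurable lebesgue"
      "(\<lambda>x. indicator \<Omega> x *\<^sub>R (v x * frechet_derivative \<phi> (at x) b)) \<in> borel_measurable lebesgue"
      using \<open>open \<Omega>\<close> by (intro borel_measurable_scaleR borel_measurable_times D ul vl borel_measurable_indicator; simp)+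
  qed (use AE in eventually_elim, simp)
  ultimately show ?thesis by (simp add: has_weak_gradient_def locally_integrable_def cong: conj_cong)
qed

lemma I_hat_cong_AE:
  fixes u v :: "'b::euclidean_space \<Rightarrow> real"
  assumes "open \<Omega>" "u \<in> borel_measurable borel" "v \<in> borel_measurable borel" "AE x in lebesgue. u x = v x"
  shows "I_hat \<Omega> p u = I_hat \<Omega> p v"
  unfolding I_hat_def weak_gradient_def has_weak_gradient_cong_AE[OF assms] ..

lemma AE_snd_nonzero: "AE x in lebesgue. snd (x :: 'a::euclidean_space \<times> real) \<noteq> 0"
proof -
  have "negligible {x :: 'a \<times> real. (0, 1) \<bullet> x = 0}" by (rule negligible_hyperplane) (auto simp: zero_prod_def)
  then have "{x :: 'a \<times> real. (0, 1) \<bullet> x = 0} \<in> null_sets lebesgue" by (simp add: negligible_iff_null_sets)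
  from AE_not_in[OF this] show ?thesis by eventually_elim (auto simp: inner_prod_def)
qed

text \<open>
  The exceptional hyperplane \<open>y = 0\<close> does not change weak gradients, so the functional sees the
  smooth representative.
\<close>

lemma I_hat_steiner_symm_plateau:
  fixes F :: "'a::euclidean_space \<Rightarrow> real \<Rightarrow> real"
  assumes "open \<Omega>"
    and F: "\<And>x s t. 0 \<le> s \<Longrightarrow> s \<le> t \<Longrightarrow> t \<le> 1 \<Longrightarrow> F x s \<le> F x t" "\<And>x. continuous_on UNIV (F x)" "\<And>x. F x 0 = 0"
    and lr: "-1 < l" "r < 1" "0 < d1" "0 < d2" "l + d1 \<le> r - d2" "c = (r - l) / 2" "d = (d1 + d2) / 2"
    and cont: "continuous_on UNIV (\<lambda>(x, y). F x (plateau (-c) c d d y))"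
  shows "I_hat \<Omega> p (steiner_symm (\<lambda>(x, y). F x (plateau l r d1 d2 y))) =
    I_hat \<Omega> p (\<lambda>(x, y). F x (plateau (-c) c d d y))"
proof -
  let ?v = "\<lambda>(x, y). F x (plateau (-c) c d d y)"
  define c0 where "c0 = (LINT t:{0 :: real..}|lebesgue. 1 :: real)"
  have v[measurable]: "?v \<in> borel_measurable borel" by (rule borel_measurable_continuous_onI[OF cont])
  have s[measurable]: "(snd :: 'a \<times> real \<Rightarrow> real) \<in> borel_measurable borel"
    by (intro borel_measurable_continuous_onI continuous_intros)
  have eq: "steiner_symm (\<lambda>(x, y). F x (plateau l r d1 d2 y)) = (\<lambda>z. if snd z = 0 then c0 else ?v z)"
  proof -
    have "steiner_symm (\<lambda>(x, y). F x (plateau l r d1 d2 y)) =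
        (\<lambda>(x, y). if y = 0 then c0 else F x (plateau (-c) c d d y))"
      unfolding c0_def by (rule steiner_symm_plateau) (use F lr in auto)
    then show ?thesis by (auto simp: fun_eq_iff)
  qed
  have "(\<lambda>z. if snd z = 0 then c0 else ?v z) \<in> borel_measurable borel" by measurable
  then show ?thesis unfolding eq
    by (rule I_hat_cong_AE[OF assms(1) _ v]) (use AE_snd_nonzero in eventually_elim, simp)
qed

section \<open>Linearization of the functional at small gradients\<close>

lemma set_integrable_compact_support:
  fixes h :: "'b::euclidean_space \<Rightarrow> real"
  assumes "compact K" "K \<subseteq> \<Omega>" "continuous_on \<Omega> h" "\<And>x. x \<in> \<Omega> \<Longrightarrow> x \<notin> K \<Longrightarrow> h x = 0"
  shows "set_integrable lborel \<Omega> h"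
proof -
  have "(\<lambda>x. indicator \<Omega> x *\<^sub>R h x) = (\<lambda>x. indicator K x *\<^sub>R h x)"
    using assms(2,4) by (auto simp: fun_eq_iff indicator_def)
  then show ?thesis using borel_integrable_compact[OF assms(1) continuous_on_subset[OF assms(3,2)]]
    by (simp add: set_integrable_def)
qed

text \<open>
  All integrands below are of the form \<open>\<Phi> (p x) |\<nabla>f x|\<^sup>2\<close> with \<open>\<Phi> q 0 = 0\<close>; they are continuous and
  vanish off the support of \<open>f\<close>. Continuity of \<open>\<Phi>\<close> is required only after composition with continuous
  functions and for nonnegative second argument, which suits \<open>powr\<close>.
\<close>

lemma set_integrable_weighted_grad:
  fixes f :: "'b::euclidean_space \<Rightarrow> real" and \<Phi> :: "real \<Rightarrow> real \<Rightarrow> real"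
  assumes f: "f \<in> Cc_smooth \<Omega>" and p: "continuous_on \<Omega> p"
    and \<Phi>: "\<And>q g. continuous_on \<Omega> q \<Longrightarrow> continuous_on \<Omega> g \<Longrightarrow> (\<And>x. x \<in> \<Omega> \<Longrightarrow> 0 \<le> g x) \<Longrightarrow>
      continuous_on \<Omega> (\<lambda>x. \<Phi> (q x) (g x))" "\<And>q. \<Phi> q 0 = 0"
  shows "set_integrable lborel \<Omega> (\<lambda>x. \<Phi> (p x) ((norm (grad f x))\<^sup>2))"
proof -
  note P = Cc_smoothD[OF f]
  show ?thesis
  proof (rule set_integrable_compact_support[OF P(2,3)])
    show "continuous_on \<Omega> (\<lambda>x. \<Phi> (p x) ((norm (grad f x))\<^sup>2))"
      by (intro \<Phi>(1) p continuous_intros continuous_on_subset[OF continuous_grad[OF P(1)]]) auto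
  next
    fix x assume "x \<notin> closure {x. f x \<noteq> 0}"
    from P(5)[OF this] show "\<Phi> (p x) ((norm (grad f x))\<^sup>2) = 0" using \<Phi>(2) by simp
  qed
qed

lemma set_integrable_excess:
  assumes "f \<in> Cc_smooth \<Omega>" "continuous_on \<Omega> p"
  shows "set_integrable lborel \<Omega> (\<lambda>x. (1 + (norm (grad f x))\<^sup>2) powr (p x / 2) - 1)"
  by (rule set_integrable_weighted_grad[OF assms, where \<Phi> = "\<lambda>q g. (1 + g) powr (q / 2) - 1"])
     (auto intro!: continuous_intros simp: add_nonneg_eq_0_iff)

lemma set_integrable_dirichlet:
  assumes "f \<in> Cc_smooth \<Omega>" "continuous_on \<Omega> p"
  shows "set_integrable lborel \<Omega> (\<lambda>x. p x * (norm (grad f x))\<^sup>2)"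
  by (rule set_integrable_weighted_grad[OF assms, where \<Phi> = "\<lambda>q g. q * g"])
     (auto intro!: continuous_intros)

text \<open>
  Splitting off the constant \<open>1\<close> leaves an integrand with compact support, and
  the finite \<open>|\<Omega>|\<close> cancels when two values are compared.
\<close>

lemma I_hat_Cc_smooth:
  fixes f :: "'b::euclidean_space \<Rightarrow> real"
  assumes \<Omega>: "open \<Omega>" "emeasure lebesgue \<Omega> < \<infinity>" and f: "f \<in> Cc_smooth \<Omega>"
    and p: "continuous_on \<Omega> p" "\<And>x. x \<in> \<Omega> \<Longrightarrow> 0 \<le> p x"
  defines "E \<equiv> (LINT x:\<Omega>|lborel. (1 + (norm (grad f x))\<^sup>2) powr (p x / 2) - 1)"
  shows "I_hat \<Omega> p f = ennreal (measure lebesgue \<Omega> + E)" "0 \<le> E"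
proof -
  define e where "e = (\<lambda>x. (1 + (norm (grad f x))\<^sup>2) powr (p x / 2) - 1)"
  have e0: "0 \<le> e x" if "x \<in> \<Omega>" for x
    using ge_one_powr_ge_zero[of "1 + (norm (grad f x))\<^sup>2" "p x / 2"] p(2)[OF that] by (simp add: e_def)
  have ie: "integrable lborel (\<lambda>x. indicator \<Omega> x *\<^sub>R e x)"
    using set_integrable_excess[OF f p(1)] by (simp add: set_integrable_def e_def)
  have ii: "integrable lborel (indicat_real \<Omega>)" using \<Omega> by (simp add: integrable_indicator_iff)
  have nn: "0 \<le> indicat_real \<Omega> x + indicator \<Omega> x *\<^sub>R e x" for x using e0 by (auto simp: indicator_def)
  have "AE x in lebesgue. ennreal ((1 + (norm (weak_gradient \<Omega> f x))\<^sup>2) powr (p x / 2)) * indicator \<Omega> x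
      = ennreal (indicat_real \<Omega> x + indicator \<Omega> x *\<^sub>R e x)"
    using weak_gradient_eq_grad[OF \<Omega>(1) Cc_smoothD(1)[OF f]]
    by eventually_elim (auto simp: e_def indicator_def)
  then have "I_hat \<Omega> p f = (\<integral>\<^sup>+x. ennreal (indicat_real \<Omega> x + indicator \<Omega> x *\<^sub>R e x) \<partial>lebesgue)"
    unfolding I_hat_def by (rule nn_integral_cong_AE)
  also have "\<dots> = (\<integral>\<^sup>+x. ennreal (indicat_real \<Omega> x + indicator \<Omega> x *\<^sub>R e x) \<partial>lborel)"
    by (rule nn_integral_completion)
  also have "\<dots> = ennreal (\<integral>x. indicat_real \<Omega> x + indicator \<Omega> x *\<^sub>R e x \<partial>lborel)"
    by (rule nn_integral_eq_integral) (use ie ii nn in auto)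
  also have "(\<integral>x. indicat_real \<Omega> x + indicator \<Omega> x *\<^sub>R e x \<partial>lborel) = measure lebesgue \<Omega> + E"
    using ie ii \<Omega>(1) by (simp add: E_def set_lebesgue_integral_def e_def[symmetric] measure_def)
  finally show "I_hat \<Omega> p f = ennreal (measure lebesgue \<Omega> + E)" .
  show "0 \<le> E" unfolding E_def set_lebesgue_integral_def e_def[symmetric]
    using e0 by (intro integral_nonneg_AE AE_I2) (auto simp: indicator_def)
qed

text \<open>
  The dominating function comes from \<open>(1 + s a)\<^sup>q \<le> e\<^sup>q\<^sup>s\<^sup>a\<close> and \<open>e\<^sup>z - 1 \<le> z e\<^sup>z\<close>, and is uniform in
  \<open>s \<in> (0, 1]\<close>.
\<close>

lemma powr_excess_quotient_bound:
  fixes a s q :: real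
  assumes "0 \<le> a" "0 < s" "s \<le> 1" "0 \<le> q"
  shows "\<bar>((1 + s * a) powr q - 1) / s\<bar> \<le> q * a * exp (q * a)"
proof -
  have sa: "0 \<le> s * a" using assms by simp
  have "1 \<le> (1 + s * a) powr q" using assms sa by (intro ge_one_powr_ge_zero) auto
  then have nn: "0 \<le> ((1 + s * a) powr q - 1) / s" using assms by simp
  have "(1 + s * a) powr q = exp (q * ln (1 + s * a))" using sa by (simp add: powr_def)
  also have "\<dots> \<le> exp (q * (s * a))" using assms sa by (simp add: mult_left_mono ln_add_one_self_le_self)
  also have "\<dots> \<le> 1 + q * (s * a) * exp (q * (s * a))"
  proof -
    have "1 - q * (s * a) \<le> exp (- (q * (s * a)))" using exp_ge_add_one_self[of "- (q * (s * a))"] by simp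
    then have "(1 - q * (s * a)) * exp (q * (s * a)) \<le> exp (- (q * (s * a))) * exp (q * (s * a))"
      by (intro mult_right_mono) auto
    also have "\<dots> = 1" by (simp add: exp_minus)
    finally show ?thesis by (simp add: algebra_simps)
  qed
  also have "q * (s * a) * exp (q * (s * a)) \<le> q * (s * a) * exp (q * a)"
    using assms by (intro mult_left_mono) (auto simp: mult_left_le_one_le mult_left_mono)
  finally have "((1 + s * a) powr q - 1) / s \<le> q * a * exp (q * a)" using assms by (simp add: field_simps)
  with nn show ?thesis by simp
qed

lemma powr_excess_quotient_tendsto:
  fixes a q :: real
  assumes "(\<lambda>n. s n) \<longlonglongrightarrow> 0" "\<And>n. s n \<noteq> 0"
  shows "(\<lambda>n. ((1 + s n * a) powr q - 1) / s n) \<longlonglongrightarrow> q * a"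
proof -
  have "((\<lambda>t. (1 + t * a) powr q) has_real_derivative q * a) (at 0)"
    by (auto intro!: derivative_eq_intros)
  then have "((\<lambda>t. ((1 + t * a) powr q - 1) / t) \<longlongrightarrow> q * a) (at 0)"
    by (simp add: has_field_derivative_iff)
  moreover have "filterlim s (at 0) sequentially" using assms by (simp add: filterlim_at)
  ultimately show ?thesis by (rule filterlim_compose)
qed

lemma grad_cmult: "Ck (Suc 0) f \<Longrightarrow> grad (\<lambda>x. c * f x) x = c *\<^sub>R grad f x"
  using GDERIV_imp_grad[OF GDERIV_mult[OF GDERIV_const Ck_1_GDERIV]] by fastforce

lemma Cc_smooth_cmult: "f \<in> Cc_smooth \<Omega> \<Longrightarrow> (\<lambda>x. c * f x) \<in> Cc_smooth \<Omega>"
  by (rule Cc_smoothI[of _ "closure {x. f x \<noteq> 0}"], rule Ck_cmult, erule Cc_smoothD(1), erule Cc_smoothD(2),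
      erule Cc_smoothD(3), drule Cc_smoothD(4), assumption, simp)

lemma excess_quotient_tendsto:
  fixes f :: "'b::euclidean_space \<Rightarrow> real"
  assumes \<Omega>: "open \<Omega>" and f: "f \<in> Cc_smooth \<Omega>"
    and p: "continuous_on \<Omega> p" "\<And>x. x \<in> \<Omega> \<Longrightarrow> 0 \<le> p x"
    and s: "s \<longlonglongrightarrow> 0" "\<And>n. 0 < s n" "\<And>n. s n \<le> (1::real)"
  shows "(\<lambda>n. (LINT x:\<Omega>|lborel. (1 + (norm (grad (\<lambda>x. s n * f x) x))\<^sup>2) powr (p x / 2) - 1) / (s n)\<^sup>2)
    \<longlonglongrightarrow> (LINT x:\<Omega>|lborel. p x * (norm (grad f x))\<^sup>2) / 2"
proof -
  let ?g = "\<lambda>x. (norm (grad f x))\<^sup>2"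
  have g: "(norm (grad (\<lambda>x. s n * f x) x))\<^sup>2 = (s n)\<^sup>2 * ?g x" for n x
    using grad_cmult[OF Cc_smoothD(1)[OF f]] by (simp add: power_mult_distrib)
  have s2: "(\<lambda>n. (s n)\<^sup>2) \<longlonglongrightarrow> 0" "(s n)\<^sup>2 \<noteq> 0" "0 < (s n)\<^sup>2" "(s n)\<^sup>2 \<le> 1" for n
    using tendsto_power[OF s(1), of 2] s(2)[of n] s(3)[of n] by (auto simp: power_le_one)
  have "(\<lambda>n. LINT x|lborel. indicator \<Omega> x *\<^sub>R (((1 + (s n)\<^sup>2 * ?g x) powr (p x / 2) - 1) / (s n)\<^sup>2))
    \<longlonglongrightarrow> (LINT x|lborel. indicator \<Omega> x *\<^sub>R (p x / 2 * ?g x))"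
  proof (rule integral_dominated_convergence[where w = "\<lambda>x. indicator \<Omega> x *\<^sub>R (p x / 2 * ?g x * exp (p x / 2 * ?g x))"])
    show "integrable lborel (\<lambda>x. indicator \<Omega> x *\<^sub>R (p x / 2 * ?g x * exp (p x / 2 * ?g x)))"
      by (fold set_integrable_def, rule set_integrable_weighted_grad[OF f p(1), where \<Phi> = "\<lambda>q g. q / 2 * g * exp (q / 2 * g)"])
         (auto intro!: continuous_intros)
    show "AE x in lborel. (\<lambda>n. indicator \<Omega> x *\<^sub>R (((1 + (s n)\<^sup>2 * ?g x) powr (p x / 2) - 1) / (s n)\<^sup>2))
      \<longlonglongrightarrow> indicator \<Omega> x *\<^sub>R (p x / 2 * ?g x)"
      by (intro AE_I2 tendsto_scaleR tendsto_const powr_excess_quotient_tendsto s2)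
    show "AE x in lborel. norm (indicator \<Omega> x *\<^sub>R (((1 + (s n)\<^sup>2 * ?g x) powr (p x / 2) - 1) / (s n)\<^sup>2))
      \<le> indicator \<Omega> x *\<^sub>R (p x / 2 * ?g x * exp (p x / 2 * ?g x))" for n
    proof (rule AE_I2)
      fix x show "norm (indicator \<Omega> x *\<^sub>R (((1 + (s n)\<^sup>2 * ?g x) powr (p x / 2) - 1) / (s n)\<^sup>2))
        \<le> indicator \<Omega> x *\<^sub>R (p x / 2 * ?g x * exp (p x / 2 * ?g x))"
        using powr_excess_quotient_bound[of "?g x" "(s n)\<^sup>2" "p x / 2"] s2 p(2)[of x]
        by (cases "x \<in> \<Omega>") auto
    qed
    show "(\<lambda>x. indicator \<Omega> x *\<^sub>R (p x / 2 * ?g x)) \<in> borel_measurable lborel"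
      using borel_measurable_integrable[OF set_integrable_dirichlet[OF f p(1), unfolded set_integrable_def]] 
      by (auto dest: borel_measurable_times[OF borel_measurable_const[of "1/2"]])
    show "(\<lambda>x. indicator \<Omega> x *\<^sub>R (((1 + (s n)\<^sup>2 * ?g x) powr (p x / 2) - 1) / (s n)\<^sup>2)) \<in> borel_measurable lborel" for n
    proof -
      have "set_integrable lborel \<Omega> (\<lambda>x. ((1 + (s n)\<^sup>2 * ?g x) powr (p x / 2) - 1) / (s n)\<^sup>2)"
        using set_integrable_excess[OF Cc_smooth_cmult[OF f] p(1), of "s n"]
        unfolding g by (rule set_integrable_divide)
      then show ?thesis unfolding set_integrable_def by (rule borel_measurable_integrable)
    qed
  qed
  then show ?thesis unfolding g set_lebesgue_integral_def by simp
qed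

lemma dirichlet_le_of_I_hat_le:
  fixes f g :: "'b::euclidean_space \<Rightarrow> real"
  assumes \<Omega>: "open \<Omega>" "emeasure lebesgue \<Omega> < \<infinity>" and f: "f \<in> Cc_smooth \<Omega>" and g: "g \<in> Cc_smooth \<Omega>"
    and p: "continuous_on \<Omega> p" "\<And>x. x \<in> \<Omega> \<Longrightarrow> 0 \<le> p x"
    and le: "\<And>s. 0 < s \<Longrightarrow> I_hat \<Omega> p (\<lambda>x. s * g x) \<le> I_hat \<Omega> p (\<lambda>x. s * f x)"
  shows "(LINT x:\<Omega>|lborel. p x * (norm (grad g x))\<^sup>2) \<le> (LINT x:\<Omega>|lborel. p x * (norm (grad f x))\<^sup>2)"
proof -
  define s where "s = (\<lambda>n. inverse (real (Suc n)))"
  have s: "s \<longlonglongrightarrow> 0" "0 < s n" "s n \<le> 1" for n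
    unfolding s_def by (rule LIMSEQ_inverse_real_of_nat) (auto simp: field_simps)
  let ?E = "\<lambda>f n. LINT x:\<Omega>|lborel. (1 + (norm (grad (\<lambda>x. s n * f x) x))\<^sup>2) powr (p x / 2) - 1"
  have "?E g n \<le> ?E f n" for n
    using le[OF s(2)[of n]] I_hat_Cc_smooth[OF \<Omega> Cc_smooth_cmult[OF f] p, of "s n"]
      I_hat_Cc_smooth[OF \<Omega> Cc_smooth_cmult[OF g] p, of "s n"] by (simp add: ennreal_le_iff)
  then have "?E g n / (s n)\<^sup>2 \<le> ?E f n / (s n)\<^sup>2" for n by (intro divide_right_mono) auto
  then have "(LINT x:\<Omega>|lborel. p x * (norm (grad g x))\<^sup>2) / 2 \<le> (LINT x:\<Omega>|lborel. p x * (norm (grad f x))\<^sup>2) / 2"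
    by (intro LIMSEQ_le[OF excess_quotient_tendsto[OF \<Omega>(1) g p s] excess_quotient_tendsto[OF \<Omega>(1) f p s]]) auto
  then show ?thesis by simp
qed

section \<open>High-frequency modulation\<close>

text \<open>
  A slowly varying part \<open>w1\<close> plus an oscillation of frequency \<open>N\<close> in direction \<open>E\<close> with envelope \<open>w2\<close>.
\<close>

definition modulated :: "(real \<Rightarrow> real) \<Rightarrow> 'b::euclidean_space \<Rightarrow> real \<Rightarrow> ('b \<Rightarrow> real) \<Rightarrow> ('b \<Rightarrow> real) \<Rightarrow> 'b \<Rightarrow> real" where
  "modulated h E N w1 w2 x = w1 x + h (N * (x \<bullet> E)) * w2 x"

lemma modulated_in_Cc_smooth:
  assumes h: "\<And>k. Ck k h" and w: "w1 \<in> Cc_smooth \<Omega>" "w2 \<in> Cc_smooth \<Omega>"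
  shows "modulated h E N w1 w2 \<in> Cc_smooth \<Omega>"
proof -
  note P = Cc_smoothD[OF w(1)] and Q = Cc_smoothD[OF w(2)]
  show ?thesis
  proof (rule Cc_smoothI[of _ "closure {x. w1 x \<noteq> 0} \<union> closure {x. w2 x \<noteq> 0}"])
    show "Ck k (modulated h E N w1 w2)" for k
      unfolding modulated_def[abs_def]
      by (intro Ck_add Ck_mult P(1) Q(1) Ck_compose_real[OF h] Ck_const Ck_bounded_linear bounded_linear_inner_left)
  next
    fix x assume "x \<notin> closure {x. w1 x \<noteq> 0} \<union> closure {x. w2 x \<noteq> 0}"
    then have "w1 x = 0" "w2 x = 0" by (auto intro: P(4) Q(4))
    then show "modulated h E N w1 w2 x = 0" by (simp add: modulated_def)
  qed (use P(2,3) Q(2,3) in auto)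
qed

lemma grad_modulated:
  assumes w: "Ck (Suc 0) w1" "Ck (Suc 0) w2" and h: "\<And>t. (h has_real_derivative h' t) (at t)"
  shows "grad (modulated h E N w1 w2) x =
    (grad w1 x + h (N * (x \<bullet> E)) *\<^sub>R grad w2 x) + (N * h' (N * (x \<bullet> E)) * w2 x) *\<^sub>R E"
proof -
  have "GDERIV (\<lambda>x. N * (x \<bullet> E)) x :> N *\<^sub>R E"
    unfolding gderiv_def by (auto intro!: derivative_eq_intros)
  then have "GDERIV (\<lambda>x. h (N * (x \<bullet> E))) x :> h' (N * (x \<bullet> E)) *\<^sub>R (N *\<^sub>R E)"
    by (rule GDERIV_DERIV_compose) (rule h)
  from GDERIV_imp_grad[OF GDERIV_add[OF Ck_1_GDERIV[OF w(1)] GDERIV_mult[OF this Ck_1_GDERIV[OF w(2)]]]]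
  show ?thesis by (simp add: modulated_def[abs_def] algebra_simps)
qed

definition modulation_error :: "('b::euclidean_space \<Rightarrow> real) \<Rightarrow> ('b \<Rightarrow> real) \<Rightarrow> 'b \<Rightarrow> real" where
  "modulation_error w1 w2 x = 2 * (norm (grad w1 x) + norm (grad w2 x))\<^sup>2
     + 4 * (norm (grad w1 x) + norm (grad w2 x)) * \<bar>w2 x\<bar>"

lemma norm_add_scaled_unit_bounds:
  fixes a E :: "'b::real_inner"
  assumes E: "norm E = 1" and a: "norm a \<le> R" and m: "\<bar>m\<bar> \<le> N * W" "0 \<le> N * W"
  shows "\<bar>(norm (a + m *\<^sub>R E))\<^sup>2 - m\<^sup>2\<bar> \<le> R\<^sup>2 + 2 * R * (N * W)"
proof -
  have "(norm (a + m *\<^sub>R E))\<^sup>2 = (norm a)\<^sup>2 + 2 * (a \<bullet> (m *\<^sub>R E)) + (norm (m *\<^sub>R E))\<^sup>2"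
    by (simp only: power2_norm_eq_inner inner_add_left inner_add_right inner_commute)
  also have "(norm (m *\<^sub>R E))\<^sup>2 = m\<^sup>2" using E by simp
  finally have eq: "(norm (a + m *\<^sub>R E))\<^sup>2 - m\<^sup>2 = (norm a)\<^sup>2 + 2 * (a \<bullet> (m *\<^sub>R E))" by simp
  have R: "0 \<le> R" using a norm_ge_zero[of a] by linarith
  have "\<bar>a \<bullet> (m *\<^sub>R E)\<bar> \<le> norm a * norm (m *\<^sub>R E)" by (rule Cauchy_Schwarz_ineq2)
  also have "\<dots> \<le> R * (N * W)" using a m E R by (intro mult_mono) auto
  finally have "\<bar>a \<bullet> (m *\<^sub>R E)\<bar> \<le> R * (N * W)" .
  moreover have "(norm a)\<^sup>2 \<le> R\<^sup>2" using a by (intro power_mono) auto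
  moreover have "0 \<le> (norm a)\<^sup>2" by simp
  ultimately show ?thesis unfolding eq by linarith
qed

text \<open>
  The gradient is \<open>N h' w2 E\<close> up to a term bounded independently of \<open>N\<close>. The squares of the leading
  terms for \<open>cos\<close> and \<open>sin\<close> add up to \<open>N\<^sup>2 w2\<^sup>2\<close> without oscillating factor, so no weak limit of
  \<open>sin\<^sup>2\<close> is needed later.
\<close>

lemma modulated_energy_bounds:
  assumes w: "Ck (Suc 0) w1" "Ck (Suc 0) w2" and E: "norm E = 1" and N: "1 \<le> N"
  shows "\<bar>(norm (grad (modulated cos E N w1 w2) x))\<^sup>2 + (norm (grad (modulated sin E N w1 w2) x))\<^sup>2
    - N\<^sup>2 * (w2 x)\<^sup>2\<bar> \<le> N * modulation_error w1 w2 x"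
proof -
  define \<theta> where "\<theta> = N * (x \<bullet> E)"
  define R where "R = norm (grad w1 x) + norm (grad w2 x)"
  have R: "norm (grad w1 x + c *\<^sub>R grad w2 x) \<le> R" if "\<bar>c\<bar> \<le> 1" for c
    using norm_triangle_ineq[of "grad w1 x" "c *\<^sub>R grad w2 x"] mult_right_mono[OF that norm_ge_zero[of "grad w2 x"]]
    by (simp add: R_def)
  have m: "\<bar>N * c * w2 x\<bar> \<le> N * \<bar>w2 x\<bar>" if "\<bar>c\<bar> \<le> 1" for c
  proof -
    have "N * (\<bar>c\<bar> * \<bar>w2 x\<bar>) \<le> N * (1 * \<bar>w2 x\<bar>)" using that N by (intro mult_left_mono mult_right_mono) auto
    then show ?thesis using N by (simp add: abs_mult)
  qed
  have b: "\<bar>(norm ((grad w1 x + c *\<^sub>R grad w2 x) + (N * c' * w2 x) *\<^sub>R E))\<^sup>2 - (N * c' * w2 x)\<^sup>2\<bar>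
      \<le> R\<^sup>2 + 2 * R * (N * \<bar>w2 x\<bar>)" if "\<bar>c\<bar> \<le> 1" "\<bar>c'\<bar> \<le> 1" for c c'
    using N by (intro norm_add_scaled_unit_bounds E R m that) auto
  have gc: "grad (modulated cos E N w1 w2) x = (grad w1 x + cos \<theta> *\<^sub>R grad w2 x) + (N * (- sin \<theta>) * w2 x) *\<^sub>R E"
    unfolding \<theta>_def by (rule grad_modulated[OF w, where h' = "\<lambda>t. - sin t"]) (auto intro!: derivative_eq_intros)
  have gs: "grad (modulated sin E N w1 w2) x = (grad w1 x + sin \<theta> *\<^sub>R grad w2 x) + (N * cos \<theta> * w2 x) *\<^sub>R E"
    unfolding \<theta>_def by (rule grad_modulated[OF w]) (auto intro!: derivative_eq_intros)
  have "(N * (- sin \<theta>) * w2 x)\<^sup>2 + (N * cos \<theta> * w2 x)\<^sup>2 = N\<^sup>2 * (w2 x)\<^sup>2 * ((sin \<theta>)\<^sup>2 + (cos \<theta>)\<^sup>2)"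
    by (simp add: power_mult_distrib algebra_simps del: sin_cos_squared_add sin_cos_squared_add2)
  then have id: "(N * (- sin \<theta>) * w2 x)\<^sup>2 + (N * cos \<theta> * w2 x)\<^sup>2 = N\<^sup>2 * (w2 x)\<^sup>2" by simp
  have "\<bar>(norm (grad (modulated cos E N w1 w2) x))\<^sup>2 + (norm (grad (modulated sin E N w1 w2) x))\<^sup>2
    - N\<^sup>2 * (w2 x)\<^sup>2\<bar> \<le> 2 * R\<^sup>2 + 4 * R * (N * \<bar>w2 x\<bar>)"
    using b[of "cos \<theta>" "- sin \<theta>"] b[of "sin \<theta>" "cos \<theta>"] id unfolding gc gs by simp
  also have "\<dots> \<le> N * (2 * R\<^sup>2) + 4 * R * (N * \<bar>w2 x\<bar>)"
    using mult_right_mono[OF N, of "2 * R\<^sup>2"] by simp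
  also have "\<dots> = N * modulation_error w1 w2 x" by (simp add: modulation_error_def R_def algebra_simps)
  finally show ?thesis .
qed

lemma set_integrable_weighted_square:
  assumes "continuous_on \<Omega> p" "w2 \<in> Cc_smooth \<Omega>"
  shows "set_integrable lborel \<Omega> (\<lambda>x. p x * (w2 x)\<^sup>2)"
proof (rule set_integrable_compact_support[OF Cc_smoothD(2,3)[OF assms(2)]])
  show "continuous_on \<Omega> (\<lambda>x. p x * (w2 x)\<^sup>2)"
    by (intro continuous_intros assms(1) continuous_on_subset[OF Ck_continuous[OF Cc_smoothD(1)[OF assms(2)]]]) auto
qed (auto dest: Cc_smoothD(4)[OF assms(2)])

lemma set_integrable_modulation_error:
  assumes p: "continuous_on \<Omega> p" and w: "w1 \<in> Cc_smooth \<Omega>" "w2 \<in> Cc_smooth \<Omega>"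
  shows "set_integrable lborel \<Omega> (\<lambda>x. p x * modulation_error w1 w2 x)"
proof -
  note P = Cc_smoothD[OF w(1)] and Q = Cc_smoothD[OF w(2)]
  show ?thesis
  proof (rule set_integrable_compact_support)
    show "compact (closure {x. w1 x \<noteq> 0} \<union> closure {x. w2 x \<noteq> 0})" "closure {x. w1 x \<noteq> 0} \<union> closure {x. w2 x \<noteq> 0} \<subseteq> \<Omega>"
      using P(2,3) Q(2,3) by auto
    show "continuous_on \<Omega> (\<lambda>x. p x * modulation_error w1 w2 x)"
      unfolding modulation_error_def
      by (intro continuous_intros p continuous_on_subset[OF Ck_continuous[OF Q(1)]]
            continuous_on_subset[OF continuous_grad[OF P(1)]] continuous_on_subset[OF continuous_grad[OF Q(1)]]) auto
    fix x assume "x \<notin> closure {x. w1 x \<noteq> 0} \<union> closure {x. w2 x \<noteq> 0}"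
    then have "grad w1 x = 0" "grad w2 x = 0" by (auto intro: P(5) Q(5))
    then show "p x * modulation_error w1 w2 x = 0" by (simp add: modulation_error_def)
  qed
qed

lemma modulated_dirichlet_bounds:
  fixes w1 w2 :: "'b::euclidean_space \<Rightarrow> real"
  assumes p: "continuous_on \<Omega> p" "\<And>x. x \<in> \<Omega> \<Longrightarrow> 0 \<le> p x"
    and w: "w1 \<in> Cc_smooth \<Omega>" "w2 \<in> Cc_smooth \<Omega>" and E: "norm E = 1" and N: "1 \<le> N"
  shows "\<bar>(LINT x:\<Omega>|lborel. p x * (norm (grad (modulated cos E N w1 w2) x))\<^sup>2)
     + (LINT x:\<Omega>|lborel. p x * (norm (grad (modulated sin E N w1 w2) x))\<^sup>2)
     - N\<^sup>2 * (LINT x:\<Omega>|lborel. p x * (w2 x)\<^sup>2)\<bar> \<le> N * (LINT x:\<Omega>|lborel. p x * modulation_error w1 w2 x)"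
    (is "\<bar>?C + ?S - _\<bar> \<le> _")
proof -
  let ?c = "\<lambda>x. p x * (norm (grad (modulated cos E N w1 w2) x))\<^sup>2"
  let ?s = "\<lambda>x. p x * (norm (grad (modulated sin E N w1 w2) x))\<^sup>2"
  let ?m = "\<lambda>x. N\<^sup>2 * (p x * (w2 x)\<^sup>2)"
  have i: "set_integrable lborel \<Omega> ?c" "set_integrable lborel \<Omega> ?s" "set_integrable lborel \<Omega> ?m"
    "set_integrable lborel \<Omega> (\<lambda>x. N * (p x * modulation_error w1 w2 x))"
    by (intro set_integrable_dirichlet modulated_in_Cc_smooth w p(1) Ck_cos Ck_sin set_integrable_mult_right
        set_integrable_weighted_square set_integrable_modulation_error)+
  have id: "set_integrable lborel \<Omega> (\<lambda>x. ?c x + ?s x - ?m x)"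
    by (intro set_integral_add set_integral_diff i)
  have eq: "?C + ?S - N\<^sup>2 * (LINT x:\<Omega>|lborel. p x * (w2 x)\<^sup>2) = (LINT x:\<Omega>|lborel. ?c x + ?s x - ?m x)"
    using i by (simp add: set_integral_add set_integral_diff)
  have "\<bar>LINT x:\<Omega>|lborel. ?c x + ?s x - ?m x\<bar> \<le> (LINT x:\<Omega>|lborel. \<bar>?c x + ?s x - ?m x\<bar>)"
    using set_integral_norm_bound[OF id] by simp
  also have "\<dots> \<le> (LINT x:\<Omega>|lborel. N * (p x * modulation_error w1 w2 x))"
  proof (rule set_integral_mono[OF set_integrable_abs[OF id] i(4)])
    fix x assume x: "x \<in> \<Omega>"
    have "p x * \<bar>(norm (grad (modulated cos E N w1 w2) x))\<^sup>2 + (norm (grad (modulated sin E N w1 w2) x))\<^sup>2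
      - N\<^sup>2 * (w2 x)\<^sup>2\<bar> \<le> p x * (N * modulation_error w1 w2 x)"
      by (intro mult_left_mono p(2) x modulated_energy_bounds E N Cc_smoothD(1)[OF w(1)] Cc_smoothD(1)[OF w(2)])
    moreover have "\<bar>?c x + ?s x - ?m x\<bar> = p x * \<bar>(norm (grad (modulated cos E N w1 w2) x))\<^sup>2
      + (norm (grad (modulated sin E N w1 w2) x))\<^sup>2 - N\<^sup>2 * (w2 x)\<^sup>2\<bar>"
    proof -
      have "?c x + ?s x - ?m x = p x * ((norm (grad (modulated cos E N w1 w2) x))\<^sup>2
        + (norm (grad (modulated sin E N w1 w2) x))\<^sup>2 - N\<^sup>2 * (w2 x)\<^sup>2)" by (simp add: algebra_simps)
      then show ?thesis using p(2)[OF x] by (simp only: abs_mult)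
    qed
    ultimately show "\<bar>?c x + ?s x - ?m x\<bar> \<le> N * (p x * modulation_error w1 w2 x)" by (simp add: algebra_simps)
  qed
  finally show ?thesis unfolding eq by simp
qed

text \<open>
  Divide by \<open>N\<^sup>2\<close> and let \<open>N\<close> tend to infinity: only the envelopes of the oscillations survive.
\<close>

lemma weighted_square_le_of_modulated:
  fixes v1 v2 w1 w2 :: "'b::euclidean_space \<Rightarrow> real"
  assumes p: "continuous_on \<Omega> p" "\<And>x. x \<in> \<Omega> \<Longrightarrow> 0 \<le> p x"
    and v: "v1 \<in> Cc_smooth \<Omega>" "v2 \<in> Cc_smooth \<Omega>" and w: "w1 \<in> Cc_smooth \<Omega>" "w2 \<in> Cc_smooth \<Omega>" and E: "norm E = 1"
    and le: "\<And>h N. h \<in> {cos, sin} \<Longrightarrow>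
      (LINT x:\<Omega>|lborel. p x * (norm (grad (modulated h E N v1 v2) x))\<^sup>2)
      \<le> (LINT x:\<Omega>|lborel. p x * (norm (grad (modulated h E N w1 w2) x))\<^sup>2)"
  shows "(LINT x:\<Omega>|lborel. p x * (v2 x)\<^sup>2) \<le> (LINT x:\<Omega>|lborel. p x * (w2 x)\<^sup>2)"
proof -
  define a where "a = (LINT x:\<Omega>|lborel. p x * (v2 x)\<^sup>2)"
  define b where "b = (LINT x:\<Omega>|lborel. p x * (w2 x)\<^sup>2)"
  define e where "e = (LINT x:\<Omega>|lborel. p x * modulation_error v1 v2 x) + (LINT x:\<Omega>|lborel. p x * modulation_error w1 w2 x)"
  have "a \<le> b + e * inverse (real (Suc n))" for n
  proof -
    define N where "N = real (Suc n)"
    have N: "N \<ge> 1" by (simp add: N_def)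
    have "N\<^sup>2 * a \<le> N\<^sup>2 * b + N * e"
      using modulated_dirichlet_bounds[OF p v E N] modulated_dirichlet_bounds[OF p w E N] le[of cos N] le[of sin N]
      by (simp add: a_def b_def e_def distrib_left)
    then have "N * (N * a) \<le> N * (N * b + e)" by (simp add: power2_eq_square algebra_simps)
    then have "N * a \<le> N * b + e" using N by simp
    then show ?thesis using N by (fold N_def) (simp add: field_simps)
  qed
  moreover have "(\<lambda>n. b + e * inverse (real (Suc n))) \<longlonglongrightarrow> b + e * 0"
    by (intro tendsto_intros LIMSEQ_inverse_real_of_nat)
  ultimately have "a \<le> b + e * 0" by (intro LIMSEQ_le_const) auto
  then show ?thesis by (simp add: a_def b_def)
qed

section \<open>Product test functions\<close>

text \<open>
  Composition with the two projections turns functions of \<open>x\<close> or \<open>y\<close> alone into functions of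
  \<open>(x, y)\<close>.
\<close>

lemma Ck_compose_linear:
  fixes L :: "'a::euclidean_space \<Rightarrow> 'b::euclidean_space"
  assumes L: "bounded_linear L"
  shows "Ck k f \<Longrightarrow> Ck k (\<lambda>x. f (L x))"
proof (induction k arbitrary: f)
  case 0 then show ?case using linear_continuous_on[OF L] by (auto intro: continuous_on_compose2)
next
  case (Suc k)
  obtain f' where f': "\<And>x. (f has_derivative f' x) (at x)" "\<And>b. b \<in> Basis \<Longrightarrow> Ck k (\<lambda>x. f' x b)"
    using Ck_SucE[OF Suc.prems] by blast
  show ?case
  proof (rule Ck_SucI)
    show "((\<lambda>x. f (L x)) has_derivative (\<lambda>h. f' (L x) (L h))) (at x)" for x
      by (rule has_derivative_compose[OF bounded_linear_imp_has_derivative[OF L] f'(1)])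
    fix b :: 'a
    have "f' y (L b) = (\<Sum>i\<in>Basis. (L b \<bullet> i) * f' y i)" for y
    proof -
      note lin = has_derivative_linear[OF f'(1)[of y]]
      have "f' y (\<Sum>i\<in>Basis. (L b \<bullet> i) *\<^sub>R i) = (\<Sum>i\<in>Basis. (L b \<bullet> i) * f' y i)"
        by (simp add: linear_sum[OF lin] linear_scale[OF lin])
      then show ?thesis by (simp only: euclidean_representation)
    qed
    moreover have "Ck k (\<lambda>x. \<Sum>i\<in>Basis. (L b \<bullet> i) * f' (L x) i)"
      by (intro Ck_sum Ck_cmult finite_Basis) (rule Suc.IH, rule f'(2))
    ultimately show "Ck k (\<lambda>x. f' (L x) (L b))" by simp
  qed
qed

lemma Cc_smooth_product:
  fixes \<psi> :: "'a::euclidean_space \<Rightarrow> real" and B :: "real \<Rightarrow> real"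
  assumes \<psi>: "\<psi> \<in> Cc_smooth \<omega>" and B: "\<And>k. Ck k B" "\<And>y. y \<notin> {l..r} \<Longrightarrow> B y = 0" "{l..r} \<subseteq> J"
  shows "(\<lambda>(x, y). \<psi> x * B y) \<in> Cc_smooth (\<omega> \<times> J)"
proof -
  note P = Cc_smoothD[OF \<psi>]
  show ?thesis
  proof (rule Cc_smoothI)
    show "Ck k (\<lambda>(x, y). \<psi> x * B y)" for k
      unfolding case_prod_beta
      by (intro Ck_mult Ck_compose_linear[where L = fst and f = \<psi>] Ck_compose_linear[where L = snd and f = B] bounded_linear_fst bounded_linear_snd P(1) B(1))
    show "compact (closure {x. \<psi> x \<noteq> 0} \<times> {l..r})" using P(2) by (intro compact_Times) auto
    show "closure {x. \<psi> x \<noteq> 0} \<times> {l..r} \<subseteq> \<omega> \<times> J" using P(3) B(3) by (intro Sigma_mono) auto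
    fix z assume "z \<notin> closure {x. \<psi> x \<noteq> 0} \<times> {l..r}"
    then have "\<psi> (fst z) = 0 \<or> B (snd z) = 0" using P(4)[of "fst z"] B(2)[of "snd z"] by (cases z) auto
    then show "(\<lambda>(x, y). \<psi> x * B y) z = 0" by (cases z) auto
  qed
qed

text \<open>
  The envelope of the oscillation as a function of the plateau function: zero where the plateau
  function is \<open>0\<close> or \<open>1\<close>, so that only the ramps contribute, and of slope at most \<open>1\<close> in absolute value
  on \<open>[0, 1]\<close>, so that \<open>t + k bell t\<close> stays monotone for \<open>|k| \<le> 1\<close>.
\<close>

definition bell :: "real \<Rightarrow> real" where "bell t = t * (1 - t)"

lemma bell_0: "bell 0 = 0"
  by (simp add: bell_def)

lemma Ck_affine: "Ck k (\<lambda>y. (y - a) / d)" "Ck k (\<lambda>y. (a - y) / d)" for a d :: real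
proof -
  have "Ck k (\<lambda>y. (1 / d) * (y - a))" "Ck k (\<lambda>y. (1 / d) * (a - y))"
    by (intro Ck_cmult Ck_diff Ck_const Ck_bounded_linear bounded_linear_ident)+
  then show "Ck k (\<lambda>y. (y - a) / d)" "Ck k (\<lambda>y. (a - y) / d)" by simp_all
qed

lemma Ck_plateau: "Ck k (plateau l r d1 d2)"
  unfolding plateau_def[abs_def]
  by (intro Ck_mult Ck_compose_real[OF Ck_step] Ck_affine)

lemma Ck_bell_comp: "Ck k f \<Longrightarrow> Ck k (\<lambda>x. bell (f x))"
  unfolding bell_def by (intro Ck_mult Ck_diff Ck_const)

lemma plateau_outside: "0 < d1 \<Longrightarrow> 0 < d2 \<Longrightarrow> y \<notin> {l..r} \<Longrightarrow> plateau l r d1 d2 y = 0"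
  by (auto simp: plateau_def smooth_step_le_0 divide_nonpos_pos not_le)

lemma plateau_bounds: "0 \<le> plateau l r d1 d2 y" "plateau l r d1 d2 y \<le> 1"
  by (auto simp: plateau_def smooth_step_bounds mult_le_one)

lemma modulation_mono:
  fixes s t k :: real
  assumes "0 \<le> s" "s \<le> t" "t \<le> 1" "\<bar>k\<bar> \<le> 1"
  shows "s + k * bell s \<le> t + k * bell t"
proof -
  have "\<bar>k * (1 - s - t)\<bar> \<le> 1 * 1" unfolding abs_mult using assms by (intro mult_mono) auto
  then have "0 \<le> 1 + k * (1 - s - t)" by linarith
  then have "0 \<le> (t - s) * (1 + k * (1 - s - t))" using assms by simp
  also have "\<dots> = (t + k * bell t) - (s + k * bell s)" by (simp add: bell_def algebra_simps)
  finally show ?thesis by simp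
qed

text \<open>
  The test functions are \<open>s \<psi>(x) (A + h(N (x \<bullet> e)) bell A)\<close> with \<open>h = cos, sin\<close> and a plateau function
  \<open>A\<close> of \<open>y\<close>; \<open>s \<rightarrow> 0\<close> linearizes the functional and \<open>N \<rightarrow> \<infinity>\<close> removes all but the oscillation.
\<close>

lemma steiner_weighted_comparison:
  fixes \<psi> :: "'a::euclidean_space \<Rightarrow> real"
  defines "J \<equiv> {-1<..<1 :: real}"
  assumes \<omega>: "open \<omega>" "emeasure lebesgue (\<omega> \<times> J) < \<infinity>"
    and p: "continuous_on (\<omega> \<times> J) p" "\<And>z. z \<in> \<omega> \<times> J \<Longrightarrow> 0 \<le> p z"
    and hyp: "\<And>u. u \<in> W11_0 (\<omega> \<times> J) \<Longrightarrow> (\<And>z. z \<in> \<omega> \<times> J \<Longrightarrow> 0 \<le> u z) \<Longrightarrow>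
           I_hat (\<omega> \<times> J) p (steiner_symm u) \<le> I_hat (\<omega> \<times> J) p u"
    and \<psi>: "\<psi> \<in> Cc_smooth \<omega>" "\<And>x. 0 \<le> \<psi> x"
    and lr: "-1 < l" "r < 1" "0 < d1" "0 < d2" "l + d1 \<le> r - d2" and c: "c = (r - l) / 2" and d: "d = (d1 + d2) / 2"
  shows "(LINT z:\<omega> \<times> J|lborel. p z * (\<psi> (fst z) * bell (plateau (-c) c d d (snd z)))\<^sup>2)
    \<le> (LINT z:\<omega> \<times> J|lborel. p z * (\<psi> (fst z) * bell (plateau l r d1 d2 (snd z)))\<^sup>2)"
proof -
  have \<Omega>: "open (\<omega> \<times> J)" using \<omega>(1) by (auto simp: J_def intro: open_Times)
  define w1 where "w1 = (\<lambda>(x, y). \<psi> x * plateau l r d1 d2 y)"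
  define w2 where "w2 = (\<lambda>(x, y). \<psi> x * bell (plateau l r d1 d2 y))"
  define v1 where "v1 = (\<lambda>(x, y). \<psi> x * plateau (-c) c d d y)"
  define v2 where "v2 = (\<lambda>(x, y). \<psi> x * bell (plateau (-c) c d d y))"
  have cd: "0 < d" "{-c..c} \<subseteq> J" "{l..r} \<subseteq> J" using lr c d by (auto simp: J_def)
  have w: "w1 \<in> Cc_smooth (\<omega> \<times> J)" "w2 \<in> Cc_smooth (\<omega> \<times> J)"
    unfolding w1_def w2_def
    by (rule Cc_smooth_product[OF \<psi>(1) _ _ cd(3)]; simp add: Ck_plateau Ck_bell_comp plateau_outside lr bell_0 del: atLeastAtMost_iff)+
  have v: "v1 \<in> Cc_smooth (\<omega> \<times> J)" "v2 \<in> Cc_smooth (\<omega> \<times> J)"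
    unfolding v1_def v2_def
    by (rule Cc_smooth_product[OF \<psi>(1) _ _ cd(2)]; simp add: Ck_plateau Ck_bell_comp plateau_outside cd(1) bell_0 del: atLeastAtMost_iff)+
  obtain e :: 'a where e: "e \<in> Basis" using nonempty_Basis by blast
  define E :: "'a \<times> real" where "E = (e, 0)"
  have E: "norm E = 1" using e by (simp add: E_def norm_Pair)
  have trig: "(LINT x:\<omega> \<times> J|lborel. p x * (norm (grad (modulated h E N v1 v2) x))\<^sup>2)
      \<le> (LINT x:\<omega> \<times> J|lborel. p x * (norm (grad (modulated h E N w1 w2) x))\<^sup>2)"
    if h: "h \<in> {cos, sin}" for h :: "real \<Rightarrow> real" and N
  proof -
    have Ckh: "Ck k h" for k using h Ck_cos Ck_sin by auto
    have h1: "\<bar>h t\<bar> \<le> 1" for t using h by auto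
    have mw: "modulated h E N w1 w2 \<in> Cc_smooth (\<omega> \<times> J)" and mv: "modulated h E N v1 v2 \<in> Cc_smooth (\<omega> \<times> J)"
      by (intro modulated_in_Cc_smooth Ckh w v)+
    show ?thesis
    proof (rule dirichlet_le_of_I_hat_le[OF \<Omega> \<omega>(2) mw mv p])
      fix s :: real assume s: "0 < s"
      define F where "F = (\<lambda>x t. s * \<psi> x * (t + h (N * (x \<bullet> e)) * bell t))"
      have Fw: "(\<lambda>z. s * modulated h E N w1 w2 z) = (\<lambda>(x, y). F x (plateau l r d1 d2 y))"
        by (auto simp: modulated_def w1_def w2_def F_def E_def inner_prod_def algebra_simps)
      have Fv: "(\<lambda>z. s * modulated h E N v1 v2 z) = (\<lambda>(x, y). F x (plateau (-c) c d d y))"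
        by (auto simp: modulated_def v1_def v2_def F_def E_def inner_prod_def algebra_simps)
      have Fmono: "F x a \<le> F x b" if "0 \<le> a" "a \<le> b" "b \<le> 1" for x a b
        unfolding F_def using s \<psi>(2) that h1 by (intro mult_left_mono modulation_mono) auto
      have F0: "F x 0 = 0" for x by (simp add: F_def bell_def)
      have Fcont: "continuous_on UNIV (F x)" for x unfolding F_def bell_def by (intro continuous_intros)
      have pos: "0 \<le> s * modulated h E N w1 w2 z" for z
      proof -
        have "0 \<le> F (fst z) (plateau l r d1 d2 (snd z))"
          using Fmono[of 0 "plateau l r d1 d2 (snd z)" "fst z"] F0 plateau_bounds by simp
        then show ?thesis using fun_cong[OF Fw, of z] by (simp add: case_prod_beta)
      qed
      have "I_hat (\<omega> \<times> J) p (\<lambda>z. s * modulated h E N v1 v2 z)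
          = I_hat (\<omega> \<times> J) p (steiner_symm (\<lambda>z. s * modulated h E N w1 w2 z))"
        unfolding Fw Fv
      proof (rule I_hat_steiner_symm_plateau[symmetric, OF \<Omega> Fmono Fcont F0 lr c d])
        show "continuous_on UNIV (\<lambda>(x, y). F x (plateau (-c) c d d y))"
          unfolding Fv[symmetric] by (rule Ck_continuous[OF Cc_smoothD(1)[OF Cc_smooth_cmult[OF mv]]])
      qed
      also have "\<dots> \<le> I_hat (\<omega> \<times> J) p (\<lambda>z. s * modulated h E N w1 w2 z)"
        by (intro hyp Cc_smooth_subset_W11_0 \<Omega> Cc_smooth_cmult mw pos)
      finally show "I_hat (\<omega> \<times> J) p (\<lambda>z. s * modulated h E N v1 v2 z)
          \<le> I_hat (\<omega> \<times> J) p (\<lambda>z. s * modulated h E N w1 w2 z)" .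
    qed
  qed
  have "(LINT z:\<omega> \<times> J|lborel. p z * (v2 z)\<^sup>2) \<le> (LINT z:\<omega> \<times> J|lborel. p z * (w2 z)\<^sup>2)"
    by (rule weighted_square_le_of_modulated[OF p v w E trig])
  then show ?thesis by (simp add: v2_def w2_def case_prod_beta)
qed

section \<open>Localization\<close>

lemma integral_product_lborel:
  fixes f :: "'a::euclidean_space \<Rightarrow> real" and g :: "real \<Rightarrow> real"
  assumes f: "continuous_on UNIV f" "compact K" "\<And>x. x \<notin> K \<Longrightarrow> f x = 0"
    and g: "continuous_on UNIV g" "\<And>y. y \<notin> {l..r} \<Longrightarrow> g y = 0"
  shows "integrable lborel (\<lambda>z. f (fst z) * g (snd z))"
    and "(\<integral>z. f (fst z) * g (snd z) \<partial>lborel) = (\<integral>x. f x \<partial>lborel) * (\<integral>y. g y \<partial>lborel)"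
proof -
  show i: "integrable lborel (\<lambda>z. f (fst z) * g (snd z))"
  proof (rule integrable_continuous_compact_support)
    show "continuous_on UNIV (\<lambda>z. f (fst z) * g (snd z))"
      by (intro continuous_intros continuous_on_compose2[OF f(1)] continuous_on_compose2[OF g(1)]) auto
    show "compact (K \<times> {l..r})" using f(2) by (intro compact_Times) auto
    show "f (fst z) * g (snd z) = 0" if "z \<notin> K \<times> {l..r}" for z
      using that f(3)[of "fst z"] g(2)[of "snd z"] by (cases z) auto
  qed
  then have "integrable (lborel \<Otimes>\<^sub>M lborel) (\<lambda>z. f (fst z) * g (snd z))" by (simp add: lborel_prod)
  from lborel_pair.integral_fst'[OF this] show "(\<integral>z. f (fst z) * g (snd z) \<partial>lborel) = (\<integral>x. f x \<partial>lborel) * (\<integral>y. g y \<partial>lborel)"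
    by (simp add: lborel_prod)
qed

text \<open>
  The squared envelope across one ramp, in the coordinate that runs from \<open>0\<close> to \<open>1\<close> along the ramp.
\<close>

definition bell_step :: "real \<Rightarrow> real" where "bell_step s = (bell (smooth_step s))\<^sup>2"

lemma bell_step_outside: "s \<notin> {0<..<1} \<Longrightarrow> bell_step s = 0"
  by (auto simp: bell_step_def bell_def smooth_step_le_0 smooth_step_ge_1 not_less)

lemma bell_step_pos: "0 < s \<Longrightarrow> s < 1 \<Longrightarrow> 0 < bell_step s"
  using smooth_step_strict[of s] by (auto simp: bell_step_def bell_def)

lemma bell_step_nonneg: "0 \<le> bell_step s"
  by (simp add: bell_step_def)

lemma continuous_bell_step: "continuous_on UNIV bell_step"
  unfolding bell_step_def[abs_def] bell_def
  by (intro continuous_intros Ck_continuous[OF Ck_step])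

lemma bell_plateau_square:
  assumes "0 < d1" "0 < d2" "l + d1 \<le> r - d2"
  shows "(bell (plateau l r d1 d2 y))\<^sup>2 = bell_step ((y - l) / d1) + bell_step ((r - y) / d2)"
proof (cases "y \<le> r - d2")
  case True
  then have "(r - y) / d2 \<ge> 1" using assms by (simp add: field_simps)
  then show ?thesis by (simp add: plateau_def smooth_step_ge_1 bell_step_def bell_def)
next
  case False
  then have "(y - l) / d1 \<ge> 1" using assms by (simp add: field_simps)
  then show ?thesis by (simp add: plateau_def smooth_step_ge_1 bell_step_def bell_def)
qed

lemma integral_pos_of_continuous:
  fixes f :: "'b::euclidean_space \<Rightarrow> real"
  assumes f: "continuous_on UNIV f" "\<And>x. 0 \<le> f x" "integrable lborel f" "0 < f x0"
  shows "0 < (\<integral>x. f x \<partial>lborel)"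
proof (rule ccontr)
  assume "\<not> 0 < (\<integral>x. f x \<partial>lborel)"
  moreover have "0 \<le> (\<integral>x. f x \<partial>lborel)" by (intro integral_nonneg_AE AE_I2 f(2))
  ultimately have "(\<integral>x. f x \<partial>lborel) = 0" by simp
  then have "AE x in lborel. f x = 0" using integral_nonneg_eq_0_iff_AE[OF f(3)] f(2) by simp
  then have "AE x in lebesgue. x \<notin> {x. 0 < f x}" using AE_completion by fastforce
  then have "{x. 0 < f x} \<in> null_sets lebesgue" 
    using borel_open[OF open_Collect_less[OF continuous_on_const f(1)]] by (intro AE_iff_null_sets[THEN iffD2]) auto
  then have "negligible {x. 0 < f x}" by (simp add: negligible_iff_null_sets)
  moreover have "open {x. 0 < f x}" by (rule open_Collect_less[OF continuous_on_const f(1)])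
  ultimately have "{x. 0 < f x} = {}" using open_not_negligible by blast
  then show False using f(4) by auto
qed

lemma exists_bump_near:
  fixes x0 :: "'a::euclidean_space"
  assumes "open \<omega>" "x0 \<in> \<omega>" "0 < \<rho>"
  obtains \<psi> where "\<psi> \<in> Cc_smooth \<omega>" "\<And>x. 0 \<le> \<psi> x" "\<And>x. x \<notin> ball x0 \<rho> \<Longrightarrow> \<psi> x = 0"
    "0 < (\<integral>x. (\<psi> x)\<^sup>2 \<partial>lborel)"
proof -
  have "open (\<omega> \<inter> ball x0 \<rho>)" "x0 \<in> \<omega> \<inter> ball x0 \<rho>" using assms by auto
  then obtain l u where lu: "cbox l u \<subseteq> \<omega> \<inter> ball x0 \<rho>" "x0 \<in> box l u"
    using open_contains_cbox by metis
  define \<psi> where "\<psi> = box_bump l u 1"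
  have \<psi>: "\<psi> \<in> Cc_smooth \<omega>" unfolding \<psi>_def by (rule box_bump_in_Cc_smooth) (use lu in auto)
  have "continuous_on UNIV \<psi>" by (rule Ck_continuous[OF Cc_smoothD(1)[OF \<psi>]])
  then have c: "continuous_on UNIV (\<lambda>x. (\<psi> x)\<^sup>2)" by (intro continuous_intros)
  have out: "\<psi> x = 0" if "x \<notin> cbox l u" for x using box_bump_zero[of x l u 1] that box_subset_cbox unfolding \<psi>_def by blast
  have i: "integrable lborel (\<lambda>x. (\<psi> x)\<^sup>2)"
    by (rule integrable_continuous_compact_support[OF c compact_cbox[of l u]]) (simp add: out)
  have smooth_step_pos: "0 < smooth_step t" if "0 < t" for t using smooth_step_strict[of t] smooth_step_ge_1[of t] that by (cases "t < 1") auto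
  have "0 < \<psi> x0" unfolding \<psi>_def box_bump_def using lu(2) by (intro prod_pos mult_pos_pos smooth_step_pos) (auto simp: mem_box)
  then have "0 < (\<integral>x. (\<psi> x)\<^sup>2 \<partial>lborel)" by (intro integral_pos_of_continuous[OF c _ i, of x0]) auto
  moreover have "0 \<le> \<psi> x" for x unfolding \<psi>_def box_bump_def by (intro prod_nonneg mult_nonneg_nonneg ballI) (auto simp: smooth_step_bounds)
  ultimately show thesis using \<psi> out subsetD[OF lu(1)] by (intro that[of \<psi>]) blast+
qed

lemma continuous_on_open_product_near:
  fixes p :: "'a::euclidean_space \<times> real \<Rightarrow> real"
  assumes "open \<Omega>" "continuous_on \<Omega> p" "(x0, t) \<in> \<Omega>" "0 < \<eta>"
  obtains \<rho> where "0 < \<rho>" "\<And>x y. x \<in> ball x0 \<rho> \<Longrightarrow> \<bar>y - t\<bar> < \<rho> \<Longrightarrow> (x, y) \<in> \<Omega> \<and> \<bar>p (x, y) - p (x0, t)\<bar> < \<eta>"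
proof -
  have "isCont p (x0, t)" using assms continuous_on_eq_continuous_at by blast
  then have "\<forall>\<^sub>F z in nhds (x0, t). dist (p z) (p (x0, t)) < \<eta>"
    using assms(4) tendstoD by (auto simp: isCont_def tendsto_at_iff_tendsto_nhds)
  moreover have "\<forall>\<^sub>F z in nhds (x0, t). z \<in> \<Omega>" using assms(1,3) by (rule eventually_nhds_in_open)
  ultimately have "\<forall>\<^sub>F z in nhds (x0, t). z \<in> \<Omega> \<and> dist (p z) (p (x0, t)) < \<eta>" by eventually_elim simp
  then obtain \<epsilon> where \<epsilon>: "0 < \<epsilon>" "\<And>z. dist z (x0, t) < \<epsilon> \<Longrightarrow> z \<in> \<Omega> \<and> dist (p z) (p (x0, t)) < \<eta>"
    by (auto simp: eventually_nhds_metric)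
  show thesis
  proof (rule that[of "\<epsilon> / 2"])
    fix x y assume "x \<in> ball x0 (\<epsilon> / 2)" "\<bar>y - t\<bar> < \<epsilon> / 2"
    then have "norm (x - x0) < \<epsilon> / 2" "norm (y - t) < \<epsilon> / 2" by (auto simp: dist_norm norm_minus_commute)
    then have "dist (x, y) (x0, t) < \<epsilon>" 
      using norm_Pair_le[of "x - x0" "y - t"] by (simp add: dist_norm)
    from \<epsilon>(2)[OF this] show "(x, y) \<in> \<Omega> \<and> \<bar>p (x, y) - p (x0, t)\<bar> < \<eta>" by (simp add: dist_real_def)
  qed (use \<epsilon> in simp)
qed


lemma bell_step_rescaled:
  assumes "0 < d"
  shows "continuous_on UNIV (\<lambda>y. bell_step ((y - l) / d))" "y \<notin> {l..l + d} \<Longrightarrow> bell_step ((y - l) / d) = 0"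
    "(\<integral>y. bell_step ((y - l) / d) \<partial>lborel) = d * (\<integral>y. bell_step y \<partial>lborel)"
    "continuous_on UNIV (\<lambda>y. bell_step ((r - y) / d))" "y \<notin> {r - d..r} \<Longrightarrow> bell_step ((r - y) / d) = 0"
    "(\<integral>y. bell_step ((r - y) / d) \<partial>lborel) = d * (\<integral>y. bell_step y \<partial>lborel)"
proof -
  show "continuous_on UNIV (\<lambda>y. bell_step ((y - l) / d))" "continuous_on UNIV (\<lambda>y. bell_step ((r - y) / d))"
    by (rule continuous_on_compose2[OF continuous_bell_step]; use assms in \<open>auto intro!: continuous_intros\<close>)+
  show "y \<notin> {l..l + d} \<Longrightarrow> bell_step ((y - l) / d) = 0" "y \<notin> {r - d..r} \<Longrightarrow> bell_step ((r - y) / d) = 0"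
    using assms by (intro bell_step_outside; auto simp: field_simps)+
  show "(\<integral>y. bell_step ((y - l) / d) \<partial>lborel) = d * (\<integral>y. bell_step y \<partial>lborel)"
    using lborel_integral_real_affine[of d "\<lambda>y. bell_step ((y - l) / d)" l] assms by simp
  show "(\<integral>y. bell_step ((r - y) / d) \<partial>lborel) = d * (\<integral>y. bell_step y \<partial>lborel)"
    using lborel_integral_real_affine[of "-d" "\<lambda>y. bell_step ((r - y) / d)" r] assms by simp
qed

lemma integral_bell_step_pos: "0 < (\<integral>y. bell_step y \<partial>lborel)"
proof (rule integral_pos_of_continuous[OF continuous_bell_step bell_step_nonneg])
  show "integrable lborel bell_step"
    by (rule integrable_continuous_compact_support[OF continuous_bell_step compact_Icc[of 0 1]])
       (auto intro: bell_step_outside)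
  show "0 < bell_step (1/2)" by (rule bell_step_pos) auto
qed

lemma integral_two_ramps:
  fixes \<psi> :: "'a::euclidean_space \<Rightarrow> real" and A B l r :: real
  assumes \<psi>: "\<psi> \<in> Cc_smooth \<omega>" and d: "0 < d1" "0 < d2"
  defines "g \<equiv> \<lambda>z. (\<psi> (fst z))\<^sup>2 * (A * bell_step ((snd z - l) / d1) + B * bell_step ((r - snd z) / d2))"
  shows "integrable lborel g" "(\<integral>z. g z \<partial>lborel) = (\<integral>x. (\<psi> x)\<^sup>2 \<partial>lborel) * (\<integral>y. bell_step y \<partial>lborel) * (A * d1 + B * d2)"
proof -
  note P = Cc_smoothD[OF \<psi>]
  have c: "continuous_on UNIV (\<lambda>x. (\<psi> x)\<^sup>2)" by (intro continuous_intros Ck_continuous[OF P(1)])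
  have z: "(\<psi> x)\<^sup>2 = 0" if "x \<notin> closure {x. \<psi> x \<noteq> 0}" for x using P(4)[OF that] by simp
  note 1 = integral_product_lborel[where l = l and r = "l + d1", OF c P(2) z bell_step_rescaled(1,2)[OF d(1), where l = l]]
  note 2 = integral_product_lborel[where l = "r - d2" and r = r, OF c P(2) z bell_step_rescaled(4,5)[OF d(2), where r = r]]
  have g: "g = (\<lambda>z. A * ((\<psi> (fst z))\<^sup>2 * bell_step ((snd z - l) / d1)) + B * ((\<psi> (fst z))\<^sup>2 * bell_step ((r - snd z) / d2)))"
    by (simp add: g_def algebra_simps)
  show "integrable lborel g" unfolding g using 1(1) 2(1) by simp
  show "(\<integral>z. g z \<partial>lborel) = (\<integral>x. (\<psi> x)\<^sup>2 \<partial>lborel) * (\<integral>y. bell_step y \<partial>lborel) * (A * d1 + B * d2)"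
    unfolding g using 1 2 bell_step_rescaled(3)[OF d(1), of l] bell_step_rescaled(6)[OF d(2), of r]
    by (simp add: algebra_simps)
qed

text \<open>
  On the supports of \<open>\<psi>\<close> and of the two ramps the weight is within \<open>\<eta>\<close> of its values at \<open>(x0, l)\<close> and
  \<open>(x0, r)\<close>, and the squared envelope has mass proportional to the width of each ramp.
\<close>

lemma weighted_ramp_bounds:
  fixes \<psi> :: "'a::euclidean_space \<Rightarrow> real" and \<Omega> :: "('a \<times> real) set"
  assumes \<psi>: "\<psi> \<in> Cc_smooth \<omega>" "\<And>x. x \<notin> ball x0 \<rho> \<Longrightarrow> \<psi> x = 0"
    and d: "0 < d1" "0 < d2" "d1 < \<rho>" "d2 < \<rho>" "l + d1 \<le> r - d2"
    and L: "\<And>x y. x \<in> ball x0 \<rho> \<Longrightarrow> \<bar>y - l\<bar> < \<rho> \<Longrightarrow> (x, y) \<in> \<Omega> \<and> \<bar>p (x, y) - p (x0, l)\<bar> < \<eta>"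
    and R: "\<And>x y. x \<in> ball x0 \<rho> \<Longrightarrow> \<bar>y - r\<bar> < \<rho> \<Longrightarrow> (x, y) \<in> \<Omega> \<and> \<bar>p (x, y) - p (x0, r)\<bar> < \<eta>"
    and i: "set_integrable lborel \<Omega> (\<lambda>z. p z * (\<psi> (fst z) * bell (plateau l r d1 d2 (snd z)))\<^sup>2)"
  defines "I \<equiv> (LINT z:\<Omega>|lborel. p z * (\<psi> (fst z) * bell (plateau l r d1 d2 (snd z)))\<^sup>2)"
    and "K \<equiv> (\<integral>x. (\<psi> x)\<^sup>2 \<partial>lborel) * (\<integral>y. bell_step y \<partial>lborel)"
  shows "I \<le> K * ((p (x0, l) + \<eta>) * d1 + (p (x0, r) + \<eta>) * d2)"
    and "K * ((p (x0, l) - \<eta>) * d1 + (p (x0, r) - \<eta>) * d2) \<le> I"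
proof -
  let ?h = "\<lambda>z. indicator \<Omega> z *\<^sub>R (p z * (\<psi> (fst z) * bell (plateau l r d1 d2 (snd z)))\<^sup>2)"
  let ?g = "\<lambda>A B z. (\<psi> (fst z))\<^sup>2 * (A * bell_step ((snd z - l) / d1) + B * bell_step ((r - snd z) / d2))"
  have ih: "integrable lborel ?h" using i by (simp add: set_integrable_def)
  have bounds: "?g (p (x0, l) - \<eta>) (p (x0, r) - \<eta>) z \<le> ?h z \<and> ?h z \<le> ?g (p (x0, l) + \<eta>) (p (x0, r) + \<eta>) z" for z
  proof (cases "\<psi> (fst z) = 0")
    case False
    obtain x y where z: "z = (x, y)" by (cases z)
    have x: "x \<in> ball x0 \<rho>" using \<psi>(2) False z by fastforce
    define a where "a = bell_step ((y - l) / d1)"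
    define b where "b = bell_step ((r - y) / d2)"
    have ab: "0 \<le> a" "0 \<le> b" by (simp_all add: a_def b_def bell_step_nonneg)
    have h: "?h z = (\<psi> x)\<^sup>2 * (indicator \<Omega> z * p z * a + indicator \<Omega> z * p z * b)"
      by (simp add: z power_mult_distrib bell_plateau_square[OF d(1,2,5)] a_def b_def algebra_simps)
    have ba: "(p (x0, l) - \<eta>) * a \<le> indicator \<Omega> z * p z * a \<and> indicator \<Omega> z * p z * a \<le> (p (x0, l) + \<eta>) * a"
    proof (cases "a = 0")
      case f: False
      then have "y \<in> {l..l + d1}" using bell_step_rescaled(2)[OF d(1)] unfolding a_def by blast
      then have "(x, y) \<in> \<Omega> \<and> \<bar>p (x, y) - p (x0, l)\<bar> < \<eta>" using d by (intro L x) auto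
      then show ?thesis using ab by (auto simp: z intro!: mult_right_mono)
    qed simp
    have bb: "(p (x0, r) - \<eta>) * b \<le> indicator \<Omega> z * p z * b \<and> indicator \<Omega> z * p z * b \<le> (p (x0, r) + \<eta>) * b"
    proof (cases "b = 0")
      case f: False
      then have "y \<in> {r - d2..r}" using bell_step_rescaled(5)[OF d(2)] unfolding b_def by blast
      then have "(x, y) \<in> \<Omega> \<and> \<bar>p (x, y) - p (x0, r)\<bar> < \<eta>" using d by (intro R x) auto
      then show ?thesis using ab by (auto simp: z intro!: mult_right_mono)
    qed simp
    show ?thesis unfolding h unfolding z fst_conv snd_conv a_def[symmetric] b_def[symmetric]
      using ba bb unfolding z by (intro conjI mult_left_mono add_mono) auto
  qed simp
  have "I = (\<integral>z. ?h z \<partial>lborel)" by (simp add: I_def set_lebesgue_integral_def)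
  moreover have "(\<integral>z. ?h z \<partial>lborel) \<le> (\<integral>z. ?g (p (x0, l) + \<eta>) (p (x0, r) + \<eta>) z \<partial>lborel)"
    by (intro integral_mono ih integral_two_ramps(1)[OF \<psi>(1) d(1,2)]) (use bounds in blast)
  moreover have "(\<integral>z. ?g (p (x0, l) - \<eta>) (p (x0, r) - \<eta>) z \<partial>lborel) \<le> (\<integral>z. ?h z \<partial>lborel)"
    by (intro integral_mono ih integral_two_ramps(1)[OF \<psi>(1) d(1,2)]) (use bounds in blast)
  ultimately show "I \<le> K * ((p (x0, l) + \<eta>) * d1 + (p (x0, r) + \<eta>) * d2)"
    "K * ((p (x0, l) - \<eta>) * d1 + (p (x0, r) - \<eta>) * d2) \<le> I"
    unfolding integral_two_ramps(2)[OF \<psi>(1) d(1,2)] K_def by simp_all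
qed

text \<open>
  A left ramp of width \<open>\<delta>\<close> and a right ramp of the much smaller width \<open>\<delta> \<tau>\<close> are symmetrized to two
  ramps of width \<open>\<delta> (1 + \<tau>)/2\<close>. As \<open>\<tau> \<rightarrow> 0\<close> the exponent near \<open>(x0, r)\<close> loses all influence, while
  the mass of the left ramp is shared equally between \<open>-c\<close> and \<open>c\<close>.
\<close>

lemma exponent_averaging_inequality:
  fixes \<omega> :: "'a::euclidean_space set"
  defines "J \<equiv> {-1<..<1 :: real}"
  assumes \<omega>: "open \<omega>" "emeasure lebesgue (\<omega> \<times> J) < \<infinity>"
    and p: "continuous_on (\<omega> \<times> J) p" "\<And>z. z \<in> \<omega> \<times> J \<Longrightarrow> 0 \<le> p z"
    and hyp: "\<And>u. u \<in> W11_0 (\<omega> \<times> J) \<Longrightarrow> (\<And>z. z \<in> \<omega> \<times> J \<Longrightarrow> 0 \<le> u z) \<Longrightarrow>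
           I_hat (\<omega> \<times> J) p (steiner_symm u) \<le> I_hat (\<omega> \<times> J) p u"
    and x0: "x0 \<in> \<omega>" and lr: "-1 < l" "l < r" "r < 1" and c: "c = (r - l) / 2"
  shows "p (x0, c) + p (x0, -c) \<le> 2 * p (x0, l)"
proof -
  have \<Omega>: "open (\<omega> \<times> J)" using \<omega>(1) by (auto simp: J_def intro: open_Times)
  have key: "(p (x0, -c) + p (x0, c) - 2 * \<eta>) * (1 + \<tau>) / 2 \<le> p (x0, l) + \<eta> + (p (x0, r) + \<eta>) * \<tau>"
    if \<eta>: "0 < \<eta>" and \<tau>: "0 < \<tau>" "\<tau> \<le> 1" for \<eta> \<tau>
  proof -
    have pts: "(x0, t) \<in> \<omega> \<times> J" if "t \<in> {l, r, c, -c}" for t using that x0 lr c by (auto simp: J_def)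
    have "\<exists>\<rho>>0. \<forall>x y. x \<in> ball x0 \<rho> \<longrightarrow> \<bar>y - t\<bar> < \<rho> \<longrightarrow> (x, y) \<in> \<omega> \<times> J \<and> \<bar>p (x, y) - p (x0, t)\<bar> < \<eta>"
      if "t \<in> {l, r, c, -c}" for t
      using continuous_on_open_product_near[OF \<Omega> p(1) pts[OF that] \<eta>] by metis
    then obtain R where R: "\<And>t. t \<in> {l, r, c, -c} \<Longrightarrow> 0 < R t"
      "\<And>t x y. t \<in> {l, r, c, -c} \<Longrightarrow> x \<in> ball x0 (R t) \<Longrightarrow> \<bar>y - t\<bar> < R t \<Longrightarrow> (x, y) \<in> \<omega> \<times> J \<and> \<bar>p (x, y) - p (x0, t)\<bar> < \<eta>"
      by metis
    define \<rho> where "\<rho> = Min (R ` {l, r, c, -c})"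
    have \<rho>: "0 < \<rho>" using R(1) by (auto simp: \<rho>_def)
    have near: "(x, y) \<in> \<omega> \<times> J \<and> \<bar>p (x, y) - p (x0, t)\<bar> < \<eta>" if "t \<in> {l, r, c, -c}" "x \<in> ball x0 \<rho>" "\<bar>y - t\<bar> < \<rho>" for t x y
    proof -
      have "\<rho> \<le> R t" unfolding \<rho>_def using that(1) by (intro Min_le) auto
      then show ?thesis using that by (intro R(2)) auto
    qed
    \<comment> \<open>With \<open>\<delta> \<le> c\<close> the two ramps do not overlap, neither before nor after symmetrization.\<close>
    define \<delta> where "\<delta> = min (\<rho> / 2) c"
    have \<delta>: "0 < \<delta>" "\<delta> < \<rho>" "\<delta> \<le> c" using \<rho> lr c by (auto simp: \<delta>_def)
    define d2 where "d2 = \<delta> * \<tau>"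
    define d where "d = (\<delta> + d2) / 2"
    have d2: "0 < d2" "d2 \<le> \<delta>" using \<delta> \<tau> by (auto simp: d2_def mult_left_le)
    have d: "0 < d" "d \<le> \<delta>" using \<delta> d2 by (auto simp: d_def)
    have fit: "l + \<delta> \<le> r - d2" "-c + d \<le> c - d" using \<delta> d2 d c by (auto simp: field_simps)
    obtain \<psi> where \<psi>: "\<psi> \<in> Cc_smooth \<omega>" "\<And>x. 0 \<le> \<psi> x" "\<And>x. x \<notin> ball x0 \<rho> \<Longrightarrow> \<psi> x = 0"
      "0 < (\<integral>x. (\<psi> x)\<^sup>2 \<partial>lborel)"
      using exists_bump_near[OF \<omega>(1) x0 \<rho>] by metis
    define K where "K = (\<integral>x. (\<psi> x)\<^sup>2 \<partial>lborel) * (\<integral>y. bell_step y \<partial>lborel)"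
    have K: "0 < K" using \<psi>(4) integral_bell_step_pos by (simp add: K_def)
    have int: "set_integrable lborel (\<omega> \<times> J) (\<lambda>z. p z * (\<psi> (fst z) * bell (plateau l' r' d1' d2' (snd z)))\<^sup>2)"
      if "-1 < l'" "r' < 1" "0 < d1'" "0 < d2'" for l' r' d1' d2'
    proof -
      have sub: "{l'..r'} \<subseteq> J" using that by (auto simp: J_def)
      have "(\<lambda>(x, y). \<psi> x * bell (plateau l' r' d1' d2' y)) \<in> Cc_smooth (\<omega> \<times> J)"
        by (rule Cc_smooth_product[OF \<psi>(1) _ _ sub])
           (simp_all add: Ck_plateau Ck_bell_comp plateau_outside that bell_0 del: atLeastAtMost_iff)
      from set_integrable_weighted_square[OF p(1) this] show ?thesis by (simp add: case_prod_beta)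
    qed
    have nl: "(x, y) \<in> \<omega> \<times> J \<and> \<bar>p (x, y) - p (x0, l)\<bar> < \<eta>" if "x \<in> ball x0 \<rho>" "\<bar>y - l\<bar> < \<rho>" for x y
      by (rule near[OF _ that]) simp
    have nr: "(x, y) \<in> \<omega> \<times> J \<and> \<bar>p (x, y) - p (x0, r)\<bar> < \<eta>" if "x \<in> ball x0 \<rho>" "\<bar>y - r\<bar> < \<rho>" for x y
      by (rule near[OF _ that]) simp
    have nc: "(x, y) \<in> \<omega> \<times> J \<and> \<bar>p (x, y) - p (x0, c)\<bar> < \<eta>" if "x \<in> ball x0 \<rho>" "\<bar>y - c\<bar> < \<rho>" for x y
      by (rule near[OF _ that]) simp
    have nm: "(x, y) \<in> \<omega> \<times> J \<and> \<bar>p (x, y) - p (x0, -c)\<bar> < \<eta>" if "x \<in> ball x0 \<rho>" "\<bar>y - -c\<bar> < \<rho>" for x y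
      by (rule near[OF _ that]) simp
    have small: "d < \<rho>" "d2 < \<rho>" "-1 < -c" "c < 1" using d d2 \<delta> lr c by auto
    have "K * ((p (x0, -c) - \<eta>) * d + (p (x0, c) - \<eta>) * d)
        \<le> (LINT z:\<omega> \<times> J|lborel. p z * (\<psi> (fst z) * bell (plateau (-c) c d d (snd z)))\<^sup>2)"
      unfolding K_def
      by (rule weighted_ramp_bounds(2)[OF \<psi>(1,3) d(1,1) small(1,1) fit(2) nm nc int[OF small(3,4) d(1,1)]])
    also have "\<dots> \<le> (LINT z:\<omega> \<times> J|lborel. p z * (\<psi> (fst z) * bell (plateau l r \<delta> d2 (snd z)))\<^sup>2)"
      unfolding J_def
      by (rule steiner_weighted_comparison[OF \<omega>[unfolded J_def] p[unfolded J_def] hyp[unfolded J_def] \<psi>(1,2) lr(1,3) \<delta>(1) d2(1) fit(1) c d_def])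
    also have "\<dots> \<le> K * ((p (x0, l) + \<eta>) * \<delta> + (p (x0, r) + \<eta>) * d2)"
      unfolding K_def
      by (rule weighted_ramp_bounds(1)[OF \<psi>(1,3) \<delta>(1) d2(1) \<delta>(2) small(2) fit(1) nl nr int[OF lr(1,3) \<delta>(1) d2(1)]])
    finally have "(p (x0, -c) - \<eta>) * d + (p (x0, c) - \<eta>) * d \<le> (p (x0, l) + \<eta>) * \<delta> + (p (x0, r) + \<eta>) * d2"
      using K by simp
    then have "((p (x0, -c) + p (x0, c) - 2 * \<eta>) * (1 + \<tau>) / 2) * \<delta> \<le> (p (x0, l) + \<eta> + (p (x0, r) + \<eta>) * \<tau>) * \<delta>"
    proof -
      have "((p (x0, -c) + p (x0, c) - 2 * \<eta>) * (1 + \<tau>) / 2) * \<delta> = (p (x0, -c) - \<eta>) * d + (p (x0, c) - \<eta>) * d"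
        by (simp add: d_def d2_def field_simps)
      moreover have "(p (x0, l) + \<eta> + (p (x0, r) + \<eta>) * \<tau>) * \<delta> = (p (x0, l) + \<eta>) * \<delta> + (p (x0, r) + \<eta>) * d2"
        by (simp add: d2_def algebra_simps)
      ultimately show ?thesis using \<open>(p (x0, -c) - \<eta>) * d + (p (x0, c) - \<eta>) * d \<le> (p (x0, l) + \<eta>) * \<delta> + (p (x0, r) + \<eta>) * d2\<close>
        by linarith
    qed
    then show ?thesis using \<delta>(1) by simp
  qed
  define s where "s = (\<lambda>n. inverse (real (Suc n)))"
  have s: "s \<longlonglongrightarrow> 0" "0 < s n" "s n \<le> 1" for n
    unfolding s_def by (rule LIMSEQ_inverse_real_of_nat) (auto simp: field_simps)
  have "(\<lambda>n. (p (x0, -c) + p (x0, c) - 2 * s n) * (1 + s n) / 2) \<longlonglongrightarrow> (p (x0, -c) + p (x0, c) - 2 * 0) * (1 + 0) / 2"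
    by (intro tendsto_intros s) auto
  moreover have "(\<lambda>n. p (x0, l) + s n + (p (x0, r) + s n) * s n) \<longlonglongrightarrow> p (x0, l) + 0 + (p (x0, r) + 0) * 0"
    by (intro tendsto_intros s)
  ultimately have "(p (x0, -c) + p (x0, c) - 2 * 0) * (1 + 0) / 2 \<le> p (x0, l) + 0 + (p (x0, r) + 0) * 0"
    by (rule LIMSEQ_le) (use key s in auto)
  then show ?thesis by simp
qed

section \<open>The averaging inequality forces constancy\<close>

text \<open>
  Small intervals show that \<open>q\<close> is minimal at \<open>0\<close>. An interval starting at \<open>-s\<close>, where \<open>q\<close> is already
  known to be minimal, forces \<open>q\<close> to be minimal at \<open>\<plusminus>y\<close> for all \<open>y < (1 + s)/2\<close>; the induction on \<open>n\<close>
  moves \<open>s\<close> through \<open>1 - 2\<^sup>-\<^sup>n\<close>.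
\<close>

lemma constant_of_averaging_inequality:
  fixes q :: "real \<Rightarrow> real"
  assumes q: "continuous_on {-1<..<1} q"
    and avg: "\<And>l r. -1 < l \<Longrightarrow> l < r \<Longrightarrow> r < 1 \<Longrightarrow> q ((r - l) / 2) + q (- ((r - l) / 2)) \<le> 2 * q l"
    and y: "\<bar>y\<bar> < 1"
  shows "q y = q 0"
proof -
  have min0: "q 0 \<le> q l" if l: "\<bar>l\<bar> < 1" for l
  proof -
    define s where "s = (\<lambda>n. (1 - l) / 2 * inverse (real (Suc n)) / 2)"
    have "s \<longlonglongrightarrow> (1 - l) / 2 * 0 / 2" unfolding s_def by (intro tendsto_intros LIMSEQ_inverse_real_of_nat) auto
    then have s0: "s \<longlonglongrightarrow> 0" by simp
    have s: "0 < s n" "l + 2 * s n < 1" for n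
    proof -
      show "0 < s n" using l by (simp add: s_def)
      have "s n \<le> (1 - l) / 2 * 1 / 2" unfolding s_def using l
        by (intro divide_right_mono mult_left_mono) (auto simp: field_simps)
      then show "l + 2 * s n < 1" using l by simp
    qed
    have c0: "isCont q 0" using q continuous_on_eq_continuous_at[of "{-1<..<1::real}" q] by auto
    have "(\<lambda>n. q (s n) + q (- s n)) \<longlonglongrightarrow> q 0 + q 0"
      using isCont_tendsto_compose[OF c0 s0] isCont_tendsto_compose[OF c0, of "\<lambda>n. - s n"] tendsto_minus[OF s0]
      by (intro tendsto_add) auto
    moreover have "q (s n) + q (- s n) \<le> 2 * q l" for n
      using avg[of l "l + 2 * s n"] s[of n] l by simp
    ultimately have "q 0 + q 0 \<le> 2 * q l" by (intro LIMSEQ_le_const2) auto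
    then show ?thesis by simp
  qed
  have spread: "q y = q 0" if y: "\<bar>y\<bar> < 1" "\<bar>y\<bar> < (1 + s) / 2" and s: "0 \<le> s" "s < 1" "q (- s) = q 0" for y s
  proof (cases "y = 0")
    case False
    have "q \<bar>y\<bar> + q (- \<bar>y\<bar>) \<le> 2 * q 0"
      using avg[of "-s" "2 * \<bar>y\<bar> - s"] s y False by simp
    moreover have "q 0 \<le> q \<bar>y\<bar>" "q 0 \<le> q (- \<bar>y\<bar>)" using y by (auto intro: min0)
    ultimately show ?thesis by (auto simp: abs_if split: if_splits)
  qed simp
  have "q y = q 0" if "\<bar>y\<bar> < 1 - (1/2) ^ n" for n y
    using that
  proof (induction n arbitrary: y)
    case (Suc n)
    define e where "e = (1/2 :: real) ^ n"
    have e: "0 < e" "e \<le> 1" by (auto simp: e_def power_le_one)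
    have y: "\<bar>y\<bar> < 1 - e / 2" using Suc.prems by (simp add: e_def)
    show ?case
    proof (cases "\<bar>y\<bar> < 1/2")
      case True then show ?thesis using spread[of y 0] by simp
    next
      case False
      \<comment> \<open>Halfway between \<open>2\<bar>y\<bar> - 1\<close>, the bound for reaching \<open>y\<close>, and \<open>1 - e\<close>, the bound in the induction hypothesis.\<close>
      define s where "s = (2 * \<bar>y\<bar> - 1 + (1 - e)) / 2"
      have s: "0 \<le> s" "s < 1 - e" "2 * \<bar>y\<bar> - 1 < s" using y False e by (auto simp: s_def field_simps)
      have "q (- s) = q 0" by (rule Suc.IH) (use s in \<open>simp add: e_def\<close>)
      then show ?thesis using s e y by (intro spread[of y s]) auto
    qed
  qed simp
  moreover obtain n where "(1/2 :: real) ^ n < 1 - \<bar>y\<bar>" using real_arch_pow_inv[of "1 - \<bar>y\<bar>" "1/2"] y by auto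
  ultimately show ?thesis by (metis less_diff_eq add.commute)
qed

lemma emeasure_cylinder_finite:
  fixes \<omega> :: "'a::euclidean_space set"
  assumes "open \<omega>" "emeasure lebesgue \<omega> < \<infinity>"
  shows "emeasure lebesgue (\<omega> \<times> {-1<..<1::real}) < \<infinity>"
proof -
  have "open (\<omega> \<times> {-1<..<1::real})" using assms(1) by (intro open_Times) auto
  then have "emeasure lebesgue (\<omega> \<times> {-1<..<1::real}) = emeasure (lborel \<Otimes>\<^sub>M lborel) (\<omega> \<times> {-1<..<1::real})"
    by (simp add: lborel_prod)
  also have "\<dots> = emeasure lborel \<omega> * emeasure lborel {-1<..<1::real}"
    using assms(1) by (intro lborel.emeasure_pair_measure_Times) auto
  also have "\<dots> < \<infinity>" using assms by (simp add: ennreal_mult_less_top)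
  finally show ?thesis .
qed

theorem theorem5:
  fixes \<omega> :: "'a::euclidean_space set"
    and \<Omega> :: "('a \<times> real) set"
    and p :: "'a \<times> real \<Rightarrow> real"
  assumes "open \<omega>" and "connected \<omega>" and "\<omega> \<noteq> {}"
    and "emeasure lebesgue \<omega> < \<infinity>"
    and "\<Omega> = \<omega> \<times> {-1<..<1}"
    and "continuous_on (closure \<Omega>) p"
    and "\<And>x. x \<in> closure \<Omega> \<Longrightarrow> 1 \<le> p x"
    and "\<And>u. u \<in> W11_0 \<Omega> \<Longrightarrow> (\<And>x. x \<in> \<Omega> \<Longrightarrow> 0 \<le> u x) \<Longrightarrow>
           I_hat \<Omega> p (steiner_symm u) \<le> I_hat \<Omega> p u"
  shows "\<forall>x'\<in>closure \<omega>. \<forall>y1\<in>{-1..1}. \<forall>y2\<in>{-1..1}. p (x', y1) = p (x', y2)"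
proof -
  note \<Omega> = \<open>\<Omega> = \<omega> \<times> {-1<..<1}\<close>
  have cl: "closure \<Omega> = closure \<omega> \<times> {-1..1}" by (simp add: \<Omega> closure_Times)
  have pc: "continuous_on (\<omega> \<times> {-1<..<1}) p"
    using assms(6) closure_subset[of \<Omega>] unfolding \<Omega> by (rule continuous_on_subset)
  have pos: "0 \<le> p z" if "z \<in> \<omega> \<times> {-1<..<1}" for z
    using assms(7)[of z] subsetD[OF closure_subset[of \<Omega>], of z] that unfolding \<Omega> by linarith
  have interior: "p (x, y) - p (x, 0) = 0" if x: "x \<in> \<omega>" and y: "\<bar>y\<bar> < 1" for x y
  proof -
    have "continuous_on {-1<..<1} (\<lambda>y. p (x, y))"
      by (rule continuous_on_compose2[OF pc]) (use x in \<open>auto intro!: continuous_intros\<close>)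
    then have "p (x, y) = p (x, 0)"
    proof (rule constant_of_averaging_inequality[where q = "\<lambda>y. p (x, y)"])
      fix l r :: real assume "-1 < l" "l < r" "r < 1"
      then show "p (x, (r - l) / 2) + p (x, - ((r - l) / 2)) \<le> 2 * p (x, l)"
        by (intro exponent_averaging_inequality[OF assms(1) emeasure_cylinder_finite[OF assms(1,4)] pc pos
              assms(8)[unfolded \<Omega>] x _ _ _ refl])
    qed (rule y)
    then show ?thesis by simp
  qed
  have "continuous_on (closure \<Omega>) (\<lambda>z. p z - p (fst z, 0))"
    by (intro continuous_on_diff assms(6) continuous_on_compose2[OF assms(6), of _ "\<lambda>z. (fst z, 0)"] continuous_intros)
       (auto simp: cl)
  then have "p z - p (fst z, 0) = 0" if "z \<in> closure \<Omega>" for z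
  proof (rule continuous_constant_on_closure[OF _ _ that])
    fix z assume "z \<in> \<Omega>"
    then have "fst z \<in> \<omega>" "\<bar>snd z\<bar> < 1" by (auto simp: \<Omega>)
    from interior[OF this] show "p z - p (fst z, 0) = 0" by (simp only: prod.collapse)
  qed
  then have "p (x, y) = p (x, 0)" if "x \<in> closure \<omega>" "y \<in> {-1..1}" for x y
    using that cl by (metis SigmaI eq_iff_diff_eq_0 fst_conv)
  then show ?thesis by metis
qed

end
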